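(* Let $p$ denote a positive integer. Every rank $2$ positive definite integral lattice $L$ with at least one screener has a $\mathbb Z$-basis $\{\alpha_1,\alpha_2\}$ with Gram matrix of one of the following two types: Type 1: $\begin{pmatrix}2p&0\\0&m\end{pmatrix}$ with $m\neq 2p$, $m\in\mathbb Z_{>0}$. Type 2: $\begin{pmatrix}2p&-p\\-p&m\end{pmatrix}$ with $m\ge p$ ($m$ an integer). The Type 2 lattices coincide with the set of rank $2$ positive definite even integral lattices that are generated by elements of the same norm. The set of screeners $\Phi$ for these two types of rank $2$ positive definite integral lattices is classified as follows. Type 1: If $m$ is odd, then $\Phi=\{\pm\alpha_1\}$, and if $m$ is even, then $\Phi=\{\pm\alpha_1,\ \pm\alpha_2\}$. Type 2: Set $\bar\Phi=\{\pm\alpha_1,\ \pm(\alpha_1+2\alpha_2)\}$. There are three subtypes: 2(a) If $m\ne 2p$ and $m\ne p$, then $\Phi=\bar\Phi$ and $\mathbb Z\Phi=\mathbb Z\bar\Phi=\mathbb Z\alpha_1\oplus\mathbb Z(\alpha_1+2\alpha_2)=\sqrt{2p}\,\mathbb Z\oplus\sqrt{4m-2p}\,\mathbb Z$. 2(b) If $m=p$, then $\mathbb Z\Phi=L=\mathbb Z(\alpha_1+\alpha_2)\oplus\mathbb Z\alpha_2=(\sqrt p\,\mathbb Z)^2=(\sqrt{p/2}\,A_1)^2$, and $\Phi=\bar\Phi\cup\{\pm\alpha_2,\ \pm(\alpha_1+\alpha_2)\}$, the total set of screeners giving the roots of the classical root system $B_2=C_2$, rescaled by $\sqrt{p/2}$.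 2(c) If $m=2p$, then $\mathbb Z\Phi=L=\sqrt p\,A_2=\sqrt p\,D_2$, and $\Phi=\bar\Phi\cup\{\pm\alpha_2,\ \pm(\alpha_1+\alpha_2),\ \pm(\alpha_1-\alpha_2),\ \pm(2\alpha_1+\alpha_2)\}$, the total set of screeners giving the roots of the exceptional root system $G_2$, rescaled by $\sqrt p$.
   Context: A positive definite integral lattice $L$ is a finitely generated free abelian group with a $\mathbb Z$-valued positive definite symmetric bilinear form $\langle\cdot,\cdot\rangle$; it is even if $\langle\alpha,\alpha\rangle\in2\mathbb Z$ for all $\alpha\in L$. Put $L^{(0)}=\{\alpha\in L:\langle\alpha,\alpha\rangle\in2\mathbb Z\}$ and $L^\circ=\{\beta\in\mathbb Q\otimes L:\langle\alpha,\beta\rangle\in\mathbb Z\text{ for all }\alpha\in L\}$. The set of screeners of $L$ is $\Phi=\{\beta\in L^{(0)}:\beta\notin 2L\text{ and }2\beta/\langle\beta,\beta\rangle\in L^\circ\}$, and $\mathbb Z\Phi$ (respectively $\mathbb Z\bar\Phi$) is the sublattice generated by $\Phi$ (respectively $\bar\Phi$). The Gram matrix of a basis $\{\alpha_1,\alpha_2\}$ is $(\langle\alpha_i,\alpha_j\rangle)$. $\oplus$ and powers denote orthogonal direct sums, and equalities with standard lattices are up to isometry. $\sqrt q\,\mathbb Z$ denotes the rank $1$ lattice whose generator $\alpha$ has $\langle\alpha,\alpha\rangle=q$; $\sqrt c\,K$ denotes the lattice $K$ with its form multiplied by $c$. The root lattices $A_1,A_2$ are normalized so that roots satisfy $\langle\alpha,\alpha\rangle=2$,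 and $D_2$ is used here as another name for $A_2$ (the convention $D_2=A_2$). The root systems $B_2$ and $G_2$ are normalized so that short roots satisfy $\langle\alpha,\alpha\rangle=2$.
   Formalization: "Generated by elements of the same norm" is read as by two elements, for any integral L, with Type 2 even iff m is even (p=m=1 gives the odd lattice Z^2). In 2(b), ZΦ=L, the eight screeners and B_2=C_2 are claimed only for even p; for odd p, where α_2 has odd norm, Φ=Φ̄. *)

theory Defs
  imports "HOL-Analysis.Analysis"
begin

text \<open>
  Lattices live inside a real inner product space, with the ambient inner product as form. Every
  abstract positive definite integral lattice \<open>L\<close> arises this way, inside the real
  vector space it spans. Positive definiteness is automatic, and inner products in \<open>\<int>\<close> make
  \<open>L\<close> discrete, so a \<open>\<int>\<close>-basis of \<open>L\<close> is linearly independent over the reals; hence the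
  rational span of \<open>L\<close> is the extension of scalars of \<open>L\<close> to the rationals.
\<close>

global_interpretation int_module:
  module "\<lambda>(k::int) (x::'a::real_vector). of_int k *\<^sub>R x"
  defines z_span = int_module.span
    and z_dependent = int_module.dependent
  by unfold_locales (simp_all add: scaleR_add_right scaleR_add_left)

global_interpretation rat_vector_space:
  vector_space "\<lambda>(q::rat) (x::'a::real_vector). of_rat q *\<^sub>R x"
  defines q_span = rat_vector_space.span
  by unfold_locales (simp_all add: scaleR_add_right scaleR_add_left of_rat_add of_rat_mult)

definition z_basis :: "'a::real_vector set \<Rightarrow> 'a set \<Rightarrow> bool" where
  "z_basis B L \<longleftrightarrow> \<not> z_dependent B \<and> z_span B = L"

definition integral_lattice :: "'a::real_inner set \<Rightarrow> bool" where
  "integral_lattice L \<longleftrightarrow> (\<exists>B. finite B \<and> z_basis B L) \<and> (\<forall>x\<in>L. \<forall>y\<in>L. x \<bullet> y \<in> \<int>)"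

definition has_rank :: "'a::real_inner set \<Rightarrow> nat \<Rightarrow> bool" where
  "has_rank L n \<longleftrightarrow> (\<exists>B. finite B \<and> card B = n \<and> z_basis B L)"

definition even_part :: "'a::real_inner set \<Rightarrow> 'a set" where
  "even_part L = {x \<in> L. \<exists>k::int. x \<bullet> x = 2 * of_int k}"

definition even_lattice :: "'a::real_inner set \<Rightarrow> bool" where
  "even_lattice L \<longleftrightarrow> integral_lattice L \<and> (\<forall>x\<in>L. \<exists>k::int. x \<bullet> x = 2 * of_int k)"

definition dual_lattice :: "'a::real_inner set \<Rightarrow> 'a set" where
  "dual_lattice L = {b \<in> q_span L. \<forall>a\<in>L. a \<bullet> b \<in> \<int>}"

definition screeners :: "'a::real_inner set \<Rightarrow> 'a set" where
  "screeners L = {b \<in> even_part L.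
     b \<notin> (\<lambda>x. 2 *\<^sub>R x) ` L \<and> (2 / (b \<bullet> b)) *\<^sub>R b \<in> dual_lattice L}"

definition gram :: "'a::real_inner \<Rightarrow> 'a \<Rightarrow> real^2^2" where
  "gram a b = vector [vector [a \<bullet> a, a \<bullet> b], vector [b \<bullet> a, b \<bullet> b]]"

definition type1_basis :: "'a::real_inner set \<Rightarrow> int \<Rightarrow> int \<Rightarrow> 'a \<Rightarrow> 'a \<Rightarrow> bool" where
  "type1_basis L p m a1 a2 \<longleftrightarrow>
     a1 \<noteq> a2 \<and> z_basis {a1, a2} L \<and> p > 0 \<and> m > 0 \<and> m \<noteq> 2 * p \<and>
     gram a1 a2 = vector [vector [of_int (2 * p), 0], vector [0, of_int m]]"

definition type2_basis :: "'a::real_inner set \<Rightarrow> int \<Rightarrow> int \<Rightarrow> 'a \<Rightarrow> 'a \<Rightarrow> bool" where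
  "type2_basis L p m a1 a2 \<longleftrightarrow>
     a1 \<noteq> a2 \<and> z_basis {a1, a2} L \<and> p > 0 \<and> m \<ge> p \<and>
     gram a1 a2 = vector [vector [of_int (2 * p), - of_int p], vector [- of_int p, of_int m]]"

definition is_orthogonal_sum :: "'a::real_inner set \<Rightarrow> 'a set \<Rightarrow> 'a set \<Rightarrow> bool" where
  "is_orthogonal_sum M A B \<longleftrightarrow>
     M = {a + b | a b. a \<in> A \<and> b \<in> B} \<and> A \<inter> B = {0} \<and> (\<forall>a\<in>A. \<forall>b\<in>B. a \<bullet> b = 0)"

text \<open>External orthogonal sums are products, which carry the sum of the two inner products.\<close>

definition lattice_isometric :: "'a::real_inner set \<Rightarrow> 'b::real_inner set \<Rightarrow> bool" where
  "lattice_isometric L M \<longleftrightarrow> (\<exists>f. bij_betw f L M \<and>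
     (\<forall>x\<in>L. \<forall>y\<in>L. f (x + y) = f x + f y) \<and> (\<forall>x\<in>L. \<forall>y\<in>L. f x \<bullet> f y = x \<bullet> y))"

text \<open>
  Scaling vectors by \<open>sqrt c\<close> multiplies the form by \<open>c\<close>. In particular
  \<open>rescale (sqrt q) \<int>\<close>, with \<open>\<int>\<close> inside the reals, is the rank one lattice with a generator
  of norm \<open>q\<close>.
\<close>

definition rescale :: "real \<Rightarrow> 'a::real_vector set \<Rightarrow> 'a set" where
  "rescale r K = (\<lambda>x. r *\<^sub>R x) ` K"

text \<open>With an index type of \<open>n + 1\<close> elements this is the root lattice of type \<open>A\<^sub>n\<close>.\<close>

definition A_root_lattice :: "(real^'n) set" where
  "A_root_lattice = {x. (\<forall>i. x $ i \<in> \<int>) \<and> (\<Sum>i\<in>UNIV. x $ i) = 0}"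

definition A1_lattice :: "(real^2) set" where "A1_lattice = A_root_lattice"

definition A2_lattice :: "(real^3) set" where "A2_lattice = A_root_lattice"

text \<open>
  The convention \<open>D\<^sub>2 = A\<^sub>2\<close> is in force here, not the usual reading of \<open>D\<^sub>2\<close> as two orthogonal
  copies of \<open>A\<^sub>1\<close>.
\<close>

definition D2_lattice :: "(real^3) set" where "D2_lattice = A2_lattice"

text \<open>
  The standard coordinates for \<open>B\<^sub>2\<close> have short roots of norm 1, whence the factor \<open>sqrt 2\<close>. In
  the standard coordinates for \<open>C\<^sub>2\<close> and \<open>G\<^sub>2\<close> the short roots already have norm 2.
\<close>

definition B2_roots :: "(real^2) set" where
  "B2_roots = rescale (sqrt 2)
     ({s *\<^sub>R axis i 1 | s i. s \<in> {-1, 1}} \<union>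
      {s *\<^sub>R axis i 1 + t *\<^sub>R axis j 1 | s t i j. s \<in> {-1, 1} \<and> t \<in> {-1, 1} \<and> i \<noteq> j})"

definition C2_roots :: "(real^2) set" where
  "C2_roots =
     {s *\<^sub>R axis i 2 | s i. s \<in> {-1, 1}} \<union>
     {s *\<^sub>R axis i 1 + t *\<^sub>R axis j 1 | s t i j. s \<in> {-1, 1} \<and> t \<in> {-1, 1} \<and> i \<noteq> j}"

definition G2_roots :: "(real^3) set" where
  "G2_roots =
     {axis i 1 - axis j 1 | i j. i \<noteq> j} \<union>
     {s *\<^sub>R (axis i 2 - axis j 1 - axis k 1) | s i j k.
        s \<in> {-1, 1} \<and> i \<noteq> j \<and> i \<noteq> k \<and> j \<noteq> k}"

definition root_set_isometric :: "'a::real_inner set \<Rightarrow> 'b::real_inner set \<Rightarrow> bool" where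
  "root_set_isometric R S \<longleftrightarrow> (\<exists>f. linear f \<and>
     (\<forall>x\<in>span R. \<forall>y\<in>span R. f x \<bullet> f y = x \<bullet> y) \<and> f ` R = S)"

definition Phi_bar :: "'a::real_vector \<Rightarrow> 'a \<Rightarrow> 'a set" where
  "Phi_bar a1 a2 = {a1, - a1, a1 + 2 *\<^sub>R a2, - (a1 + 2 *\<^sub>R a2)}"

end

theory Submission
  imports Defs
begin

text \<open>
  A screener is a primitive vector whose reflection preserves \<open>L\<close>, and it can be completed to a basis
  \<open>{\<beta>, \<gamma>}\<close>. With \<open>\<langle>\<beta>, \<beta>\<rangle> = 2p\<close> the screener condition says that \<open>p\<close> divides \<open>\<langle>\<beta>, \<gamma>\<rangle>\<close>, and
  subtracting a multiple of \<open>\<beta>\<close> from \<open>\<gamma>\<close> makes this product \<open>0\<close> or \<open>-p\<close>: the cell is rectangular or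
  rhombic. In the rectangular case a square cell is also rhombic; in the rhombic case with \<open>m < p\<close> the
  roles of the two orthogonal diagonals \<open>\<alpha>\<^sub>1\<close> and \<open>\<alpha>\<^sub>1 + 2\<alpha>\<^sub>2\<close> are exchanged.

  To determine all screeners, write vectors in coordinates along the orthogonal pair. The screener
  condition bounds the norm of a vector by a linear function of each of its coordinates, which leaves
  finitely many candidates off the axes, and divisibility then forces \<open>m = p\<close> or \<open>m = 2p\<close>.
\<close>

section \<open>Gram determinants and isometries\<close>

text \<open>Nonvanishing stands for independence of the pair; by Cauchy-Schwarz it is the same as
  positivity.\<close>

definition gram_det :: "'a::real_inner \<Rightarrow> 'a \<Rightarrow> real" where
  "gram_det a b = (a \<bullet> a) * (b \<bullet> b) - (a \<bullet> b)\<^sup>2"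

lemma gram_det_nonneg: "gram_det a b \<ge> 0"
  unfolding gram_det_def using Cauchy_Schwarz_ineq[of a b] by simp

text \<open>A change of vectors turns the Gram matrix into a congruent one, so its determinant picks
  up the square of the determinant of the coefficient matrix.\<close>

lemma gram_det_combination:
  "gram_det (x *\<^sub>R a + y *\<^sub>R b) (z *\<^sub>R a + w *\<^sub>R b) = (x * w - y * z)\<^sup>2 * gram_det a b"
  unfolding gram_det_def
  by (simp add: inner_simps inner_commute[of b a]) algebra

text \<open>The zero vector has Gram determinant zero with every vector; testing it against
  \<open>a\<close> and against \<open>b\<close> isolates \<open>y\<close> and
  \<open>x\<close>.\<close>

lemma gram_det_combination_eq_0:
  assumes "gram_det a b \<noteq> 0" and "x *\<^sub>R a + y *\<^sub>R b = 0"
  shows "x = 0 \<and> y = 0"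
proof -
  have "gram_det (x *\<^sub>R a + y *\<^sub>R b) (z *\<^sub>R a + w *\<^sub>R b) = 0" for z w
    unfolding assms(2) by (simp add: gram_det_def)
  then have "x * w - y * z = 0" for z w
    using assms(1) by (simp add: gram_det_combination)
  from this[of 1 0] this[of 0 1] show ?thesis by simp
qed

lemma gram_det_combination_eq_iff:
  assumes "gram_det a b \<noteq> 0"
  shows "x *\<^sub>R a + y *\<^sub>R b = z *\<^sub>R a + w *\<^sub>R b \<longleftrightarrow> x = z \<and> y = w"
proof
  assume "x *\<^sub>R a + y *\<^sub>R b = z *\<^sub>R a + w *\<^sub>R b"
  then have "(x - z) *\<^sub>R a + (y - w) *\<^sub>R b = 0"
    by (simp add: algebra_simps)
  from gram_det_combination_eq_0[OF assms this] show "x = z \<and> y = w" by simp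
qed simp

lemma z_span_pair: "z_span {a, b} = {of_int x *\<^sub>R a + of_int y *\<^sub>R b | x y. True}"
proof -
  have "v \<in> z_span {a, b} \<longleftrightarrow> (\<exists>x y. v = of_int x *\<^sub>R a + of_int y *\<^sub>R b)" for v
    unfolding int_module.span_insert[of a] int_module.span_singleton
    by (auto simp: image_iff algebra_simps)
  then show ?thesis by blast
qed

lemma z_span_pairE:
  assumes "v \<in> z_span {a, b}"
  obtains x y where "v = of_int x *\<^sub>R a + of_int y *\<^sub>R b"
  using assms unfolding z_span_pair by blast

lemma z_span_pairI: "of_int x *\<^sub>R a + of_int y *\<^sub>R b \<in> z_span {a, b}"
  unfolding z_span_pair by blast

text \<open>The component of \<open>a\<close> orthogonal to \<open>b\<close>, multiplied by
  \<open>b \<bullet> b\<close>, has integral coefficients, and its norm is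
  \<open>(b \<bullet> b) * gram_det a b\<close>. A vanishing determinant therefore yields an integer
  relation. Conversely, a nonzero determinant excludes relations even with real
  coefficients.\<close>

lemma independent_pair_iff:
  assumes "a \<bullet> b \<in> \<int>" and "b \<bullet> b \<in> \<int>"
  shows "a \<noteq> b \<and> \<not> z_dependent {a, b} \<longleftrightarrow> gram_det a b \<noteq> 0"
proof
  assume ind: "a \<noteq> b \<and> \<not> z_dependent {a, b}"
  obtain B where B: "a \<bullet> b = of_int B" using assms(1) by (rule Ints_cases)
  obtain C where C: "b \<bullet> b = of_int C" using assms(2) by (rule Ints_cases)
  show "gram_det a b \<noteq> 0"
  proof
    assume "gram_det a b = 0"
    define w where "w = of_int C *\<^sub>R a - of_int B *\<^sub>R b"
    have "w \<bullet> w = (b \<bullet> b) * gram_det a b"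
      unfolding w_def gram_det_def B[symmetric] C[symmetric]
      by (simp add: inner_simps inner_commute[of b a] power2_eq_square algebra_simps)
    then have "w = 0" using \<open>gram_det a b = 0\<close> by simp
    have "b \<noteq> 0" using ind int_module.dependent_zero[of "{a, b}"] by auto
    then have "C \<noteq> 0" using C by auto
    define u where "u v = (if v = a then C else - B)" for v
    have "u a \<noteq> 0" using \<open>C \<noteq> 0\<close> by (simp add: u_def)
    moreover have "(\<Sum>v\<in>{a, b}. of_int (u v) *\<^sub>R v) = 0"
      using ind \<open>w = 0\<close> by (auto simp: w_def u_def)
    ultimately have "z_dependent {a, b}"
      unfolding int_module.dependent_finite[of "{a, b}", simplified] by blast
    then show False using ind by blast
  qed
next
  assume D: "gram_det a b \<noteq> 0"
  have "a \<noteq> b" using D by (auto simp: gram_det_def power2_eq_square)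
  moreover have "\<not> z_dependent {a, b}"
  proof
    assume "z_dependent {a, b}"
    then obtain u where "u a \<noteq> 0 \<or> u b \<noteq> (0::int)"
        "of_int (u a) *\<^sub>R a + of_int (u b) *\<^sub>R b = 0"
      using \<open>a \<noteq> b\<close> by (auto simp: int_module.dependent_finite)
    then show False using gram_det_combination_eq_0[OF D] by fastforce
  qed
  ultimately show "a \<noteq> b \<and> \<not> z_dependent {a, b}" by blast
qed

lemma gram_det_nonzero_z_span:
  assumes "z_span {a, b} = z_span {c, d}" and "gram_det a b \<noteq> 0"
  shows "gram_det c d \<noteq> 0"
proof -
  have "a \<in> z_span {c, d}" "b \<in> z_span {c, d}"
    using assms(1) int_module.span_superset[of "{a, b}"] by auto
  then obtain x y z w where "a = of_int x *\<^sub>R c + of_int y *\<^sub>R d" "b = of_int z *\<^sub>R c + of_int w *\<^sub>R d"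
    by (metis z_span_pairE)
  then show ?thesis using assms(2) gram_det_combination by (metis mult_zero_right)
qed

lemma z_span_unimodular:
  fixes x y z w :: int
  assumes "x * w - y * z = 1"
  shows "z_span {of_int x *\<^sub>R a + of_int y *\<^sub>R b, of_int z *\<^sub>R a + of_int w *\<^sub>R b} = z_span {a, b}"
    (is "z_span {?c, ?d} = _")
  unfolding int_module.span_eq
proof
  show "{?c, ?d} \<subseteq> z_span {a, b}" by (auto intro: z_span_pairI)
  have "of_int x * of_int w - of_int y * of_int z = (1::real)"
    using assms by (metis of_int_1 of_int_diff of_int_mult)
  then have "(of_int x * of_int w) *\<^sub>R v - (of_int y * of_int z) *\<^sub>R v = v" for v :: 'a
    by (metis scaleR_diff_left scaleR_one)
  \<comment> \<open>The coefficients form the adjugate of the given matrix, which is its inverse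
    because the determinant is 1.\<close>
  then have "of_int w *\<^sub>R ?c + of_int (- y) *\<^sub>R ?d = a"
      "of_int (- z) *\<^sub>R ?c + of_int x *\<^sub>R ?d = b"
    by (simp_all add: algebra_simps)
  then show "{a, b} \<subseteq> z_span {?c, ?d}"
    using z_span_pairI[of w ?c "- y" ?d] z_span_pairI[of "- z" ?c x ?d] by simp
qed

section \<open>Isometries between pairs with equal Gram matrices\<close>

lemma gram_isometry:
  assumes D: "gram_det a b \<noteq> 0"
    and gram: "c \<bullet> c = a \<bullet> a" "c \<bullet> d = a \<bullet> b" "d \<bullet> d = b \<bullet> b"
  obtains f where "linear f" "\<And>x y. f (x *\<^sub>R a + y *\<^sub>R b) = x *\<^sub>R c + y *\<^sub>R d"
    "\<And>v w. v \<in> span {a, b} \<Longrightarrow> w \<in> span {a, b} \<Longrightarrow> f v \<bullet> f w = v \<bullet> w"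
proof -
  define D where "D = gram_det a b"
  \<comment> \<open>Cramer's rule recovers the coordinates of \<open>v\<close> from its inner
    products with \<open>a\<close> and \<open>b\<close>. This formula is linear on the whole space
    and kills the orthogonal complement of the pair, so the form is preserved on the span
    only.\<close>
  define f where "f v = (((v \<bullet> a) * (b \<bullet> b) - (v \<bullet> b) * (a \<bullet> b)) / D) *\<^sub>R c
      + (((v \<bullet> b) * (a \<bullet> a) - (v \<bullet> a) * (a \<bullet> b)) / D) *\<^sub>R d" for v
  have lin: "linear f"
    by (rule linearI) (simp_all add: f_def inner_simps add_divide_distrib diff_divide_distrib algebra_simps)
  have "((x *\<^sub>R a + y *\<^sub>R b) \<bullet> a) * (b \<bullet> b) - ((x *\<^sub>R a + y *\<^sub>R b) \<bullet> b) * (a \<bullet> b) = x * D"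
       "((x *\<^sub>R a + y *\<^sub>R b) \<bullet> b) * (a \<bullet> a) - ((x *\<^sub>R a + y *\<^sub>R b) \<bullet> a) * (a \<bullet> b) = y * D" for x y
    unfolding D_def gram_det_def
    by (simp_all add: inner_simps inner_commute[of b a] power2_eq_square algebra_simps)
  then have comb: "f (x *\<^sub>R a + y *\<^sub>R b) = x *\<^sub>R c + y *\<^sub>R d" for x y
    using assms(1) by (simp add: f_def D_def)
  have "f v \<bullet> f w = v \<bullet> w" if "v \<in> span {a, b}" "w \<in> span {a, b}" for v w
  proof -
    have "\<exists>x y. v = x *\<^sub>R a + y *\<^sub>R b" if "v \<in> span {a, b}" for v
      using that unfolding span_insert[of a] span_singleton by (auto simp: image_iff algebra_simps)
    from this[OF that(1)] this[OF that(2)]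
    obtain x y z t where "v = x *\<^sub>R a + y *\<^sub>R b" "w = z *\<^sub>R a + t *\<^sub>R b"
      by blast
    then show ?thesis
      by (simp add: comb gram inner_simps inner_commute[of b a] inner_commute[of d c])
  qed
  with lin comb show thesis by (rule that)
qed

lemma lattice_isometric_z_span:
  assumes "gram_det a b \<noteq> 0"
    and "c \<bullet> c = a \<bullet> a" "c \<bullet> d = a \<bullet> b" "d \<bullet> d = b \<bullet> b"
  shows "lattice_isometric (z_span {a, b}) (z_span {c, d})"
proof -
  obtain f where f: "linear f" "\<And>x y. f (x *\<^sub>R a + y *\<^sub>R b) = x *\<^sub>R c + y *\<^sub>R d"
    "\<And>v w. v \<in> span {a, b} \<Longrightarrow> w \<in> span {a, b} \<Longrightarrow> f v \<bullet> f w = v \<bullet> w"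
    using gram_isometry[OF assms] by metis
  have sub: "v \<in> span {a, b}" if "v \<in> z_span {a, b}" for v
    using that by (auto elim!: z_span_pairE intro!: span_add span_scale intro: span_base)
  have "inj_on f (z_span {a, b})"
  proof (rule inj_onI)
    fix v w assume vw: "v \<in> z_span {a, b}" "w \<in> z_span {a, b}" "f v = f w"
    then have "v - w \<in> span {a, b}" by (intro span_diff sub)
    then have "(v - w) \<bullet> (v - w) = f (v - w) \<bullet> f (v - w)" using f(3) by simp
    then show "v = w" using vw(3) by (simp add: linear_diff[OF f(1)])
  qed
  moreover have "f ` z_span {a, b} = z_span {c, d}"
  proof (intro subset_antisym subsetI)
    fix v assume "v \<in> f ` z_span {a, b}"
    then show "v \<in> z_span {c, d}" by (auto elim!: z_span_pairE simp: f(2) z_span_pairI)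
  next
    fix v assume "v \<in> z_span {c, d}"
    then show "v \<in> f ` z_span {a, b}"
      by (metis z_span_pairE f(2) image_eqI z_span_pairI)
  qed
  ultimately show ?thesis
    unfolding lattice_isometric_def bij_betw_def
    using f sub by (intro exI[of _ f]) (auto simp: linear_add)
qed

text \<open>Root sets are compared through one common set of coordinates: the map that matches two
  pairs with the same Gram matrix then matches the sets.\<close>

lemma root_set_isometric_combinations:
  fixes I :: "(real \<times> real) set"
  assumes "gram_det a b \<noteq> 0"
    and "c \<bullet> c = a \<bullet> a" "c \<bullet> d = a \<bullet> b" "d \<bullet> d = b \<bullet> b"
    and R: "R = (\<lambda>(x, y). x *\<^sub>R a + y *\<^sub>R b) ` I"
    and S: "S = (\<lambda>(x, y). x *\<^sub>R c + y *\<^sub>R d) ` I"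
  shows "root_set_isometric R S"
proof -
  obtain f where f: "linear f" "\<And>x y. f (x *\<^sub>R a + y *\<^sub>R b) = x *\<^sub>R c + y *\<^sub>R d"
    "\<And>v w. v \<in> span {a, b} \<Longrightarrow> w \<in> span {a, b} \<Longrightarrow> f v \<bullet> f w = v \<bullet> w"
    using gram_isometry[OF assms(1-4)] by metis
  have "span R \<subseteq> span {a, b}"
    by (rule span_minimal) (auto simp: R intro!: span_add span_scale intro: span_base)
  moreover have "f ` R = S"
    by (simp add: R S image_image f(2) case_prod_unfold)
  ultimately show ?thesis
    unfolding root_set_isometric_def using f by blast
qed

lemma root_set_isometric_rescale:
  fixes I :: "(real \<times> real) set"
  assumes "gram_det a b \<noteq> 0"
    and "r\<^sup>2 * (c \<bullet> c) = a \<bullet> a" "r\<^sup>2 * (c \<bullet> d) = a \<bullet> b" "r\<^sup>2 * (d \<bullet> d) = b \<bullet> b"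
    and R: "R = (\<lambda>(x, y). x *\<^sub>R a + y *\<^sub>R b) ` I"
    and S: "S = (\<lambda>(x, y). x *\<^sub>R c + y *\<^sub>R d) ` I"
  shows "root_set_isometric R (rescale r S)"
proof (rule root_set_isometric_combinations[OF assms(1) _ _ _ R])
  show "rescale r S = (\<lambda>(x, y). x *\<^sub>R (r *\<^sub>R c) + y *\<^sub>R (r *\<^sub>R d)) ` I"
    by (simp add: S rescale_def image_image case_prod_unfold scaleR_add_right mult.commute)
qed (use assms(2-4) in \<open>simp_all add: power2_eq_square mult.assoc\<close>)

section \<open>Explicit generators and coordinates for the standard lattices and root
  systems\<close>

lemma z_span_singleton: "z_span {a} = {of_int x *\<^sub>R a | x. True}"
  unfolding int_module.span_singleton by blast

lemma rescale_z_span_singleton: "rescale r (z_span {a}) = z_span {r *\<^sub>R a}"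
  unfolding rescale_def int_module.span_singleton by (simp add: image_image mult.commute)

lemma rescale_z_span_pair: "rescale r (z_span {a, b}) = z_span {r *\<^sub>R a, r *\<^sub>R b}"
proof -
  have "r *\<^sub>R (of_int x *\<^sub>R a + of_int y *\<^sub>R b) = of_int x *\<^sub>R (r *\<^sub>R a) + of_int y *\<^sub>R (r *\<^sub>R b)" for x y
    by (simp add: scaleR_add_right mult.commute)
  then show ?thesis unfolding rescale_def z_span_pair by (auto simp: image_iff) metis+
qed

lemma z_span_Times: "z_span {a} \<times> z_span {b} = z_span {(a, 0), (0, b)}"
  unfolding z_span_pair z_span_singleton by auto

lemma Ints_eq_z_span: "(\<int> :: real set) = z_span {1}"
  unfolding int_module.span_singleton Ints_def by simp

lemma vector_2_eq_iff: "(v :: real^2) = vector [x, y] \<longleftrightarrow> v $ 1 = x \<and> v $ 2 = y"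
  by (simp add: vec_eq_iff forall_2)

lemma vector_3_eq_iff: "(v :: real^3) = vector [x, y, z] \<longleftrightarrow> v $ 1 = x \<and> v $ 2 = y \<and> v $ 3 = z"
  by (simp add: vec_eq_iff forall_3)

lemma A1_lattice_eq: "A1_lattice = z_span {vector [1, - 1]}"
proof -
  have "v \<in> A1_lattice \<longleftrightarrow> v \<in> z_span {vector [1, - 1]}" for v
  proof
    assume "v \<in> A1_lattice"
    then have "v $ 1 \<in> \<int>" "v $ 2 = - v $ 1"
      by (auto simp: A1_lattice_def A_root_lattice_def sum_2)
    then obtain k where "v $ 1 = of_int k" "v $ 2 = - of_int k" by (auto elim!: Ints_cases)
    then have "v = of_int k *\<^sub>R vector [1, - 1]" by (simp add: vec_eq_iff forall_2)
    then show "v \<in> z_span {vector [1, - 1]}" unfolding z_span_singleton by blast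
  qed (auto simp: A1_lattice_def A_root_lattice_def z_span_singleton sum_2 forall_2)
  then show ?thesis by blast
qed

lemma A2_lattice_eq: "A2_lattice = z_span {vector [1, - 1, 0], vector [0, 1, - 1]}"
proof -
  have "v \<in> A2_lattice \<longleftrightarrow> v \<in> z_span {vector [1, - 1, 0], vector [0, 1, - 1]}" for v
  proof
    assume "v \<in> A2_lattice"
    then have ints: "v $ 1 \<in> \<int>" "v $ 3 \<in> \<int>" and "v $ 1 + (v $ 2 + v $ 3) = 0"
      unfolding A2_lattice_def A_root_lattice_def by (auto simp: sum_3)
    from ints(1) obtain k where "v $ 1 = of_int k" by (rule Ints_cases)
    moreover from ints(2) obtain l where "v $ 3 = of_int l" by (rule Ints_cases)
    ultimately have "v $ 1 = of_int k" "v $ 3 = of_int l" "v $ 2 = - of_int k - of_int l"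
      using \<open>v $ 1 + (v $ 2 + v $ 3) = 0\<close> by linarith+
    then have "v = of_int k *\<^sub>R vector [1, - 1, 0] + of_int (- l) *\<^sub>R vector [0, 1, - 1]"
      by (simp add: vec_eq_iff forall_3)
    then show "v \<in> z_span {vector [1, - 1, 0], vector [0, 1, - 1]}" unfolding z_span_pair by blast
  qed (auto simp: A2_lattice_def A_root_lattice_def z_span_pair sum_3 forall_3)
  then show ?thesis by blast
qed

lemma ex_2: "(\<exists>i::2. P i) \<longleftrightarrow> P 1 \<or> P 2"
  by (metis exhaust_2)

lemma ex_3: "(\<exists>i::3. P i) \<longleftrightarrow> P 1 \<or> P 2 \<or> P 3"
  by (metis exhaust_3)

lemma axis_2_eq: "axis 1 x = (vector [x, 0] :: real^2)" "axis 2 x = (vector [0, x] :: real^2)"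
  by (simp_all add: vector_2_eq_iff axis_def)

lemma axis_3_eq:
  "axis 1 x = (vector [x, 0, 0] :: real^3)" "axis 2 x = (vector [0, x, 0] :: real^3)"
  "axis 3 x = (vector [0, 0, x] :: real^3)"
  by (simp_all add: vector_3_eq_iff axis_def)

lemma vector_2_arith:
  "vector [x, y] + vector [z, w] = (vector [x + z, y + w] :: real^2)"
  "vector [x, y] - vector [z, w] = (vector [x - z, y - w] :: real^2)"
  "- vector [x, y] = (vector [- x, - y] :: real^2)"
  "r *\<^sub>R vector [x, y] = (vector [r * x, r * y] :: real^2)"
  by (simp_all add: vector_2_eq_iff)

lemma vector_3_arith:
  "vector [x, y, t] + vector [z, w, u] = (vector [x + z, y + w, t + u] :: real^3)"
  "vector [x, y, t] - vector [z, w, u] = (vector [x - z, y - w, t - u] :: real^3)"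
  "- vector [x, y, t] = (vector [- x, - y, - t] :: real^3)"
  "r *\<^sub>R vector [x, y, t] = (vector [r * x, r * y, r * t] :: real^3)"
  by (simp_all add: vector_3_eq_iff)

lemma inner_vector_2: "(vector [x, y] :: real^2) \<bullet> vector [z, w] = x * z + y * w"
  by (simp add: inner_vec_def sum_2)

lemma inner_vector_3: "(vector [x, y, t] :: real^3) \<bullet> vector [z, w, u] = x * z + y * w + t * u"
  by (simp add: inner_vec_def sum_3)

lemma signed_axes_2:
  "{s *\<^sub>R axis i x | s i. s \<in> {-1, 1}} =
    {vector [x, 0], vector [- x, 0], vector [0, x], vector [0, - x] :: real^2}"
  by (auto simp: ex_2 axis_2_eq vector_2_arith)
    ((rule exI[of _ 1], force) | (rule exI[of _ "- 1"], force))+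

lemma signed_axis_pairs_2:
  "{s *\<^sub>R axis i 1 + t *\<^sub>R axis j 1 | s t i j. s \<in> {-1, 1} \<and> t \<in> {-1, 1} \<and> i \<noteq> j} =
    {vector [1, 1], vector [1, - 1], vector [- 1, 1], vector [- 1, - 1] :: real^2}"
  by (auto simp: ex_2 axis_2_eq vector_2_arith)

text \<open>Coordinates along an orthogonal pair of short roots. The pairs \<open>sqrt 2\<close>
  times the unit vectors for type B and \<open>[1, 1]\<close>, \<open>[1, - 1]\<close> for type C
  have the same Gram matrix, so this one list exhibits both root systems.\<close>

definition B2_coords :: "(real \<times> real) set" where
  "B2_coords = {(1, 0), (- 1, 0), (0, 1), (0, - 1), (1, 1), (1, - 1), (- 1, 1), (- 1, - 1)}"

lemma B2_roots_eq:
  "B2_roots = (\<lambda>(x, y). x *\<^sub>R vector [sqrt 2, 0] + y *\<^sub>R vector [0, sqrt 2]) ` B2_coords"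
  unfolding B2_roots_def signed_axes_2 signed_axis_pairs_2
  by (auto simp: rescale_def B2_coords_def vector_2_arith)

lemma C2_roots_eq:
  "C2_roots = (\<lambda>(x, y). x *\<^sub>R vector [1, 1] + y *\<^sub>R vector [1, - 1]) ` B2_coords"
  unfolding C2_roots_def signed_axes_2 signed_axis_pairs_2
  by (auto simp: B2_coords_def vector_2_arith)

text \<open>Coordinates along two short roots of norm 2 with inner product \<open>- 1\<close>. The
  short roots are \<open>(1, 0)\<close>, \<open>(0, 1)\<close>, \<open>(1, 1)\<close> and the long
  ones \<open>(1, 2)\<close>, \<open>(1, - 1)\<close>, \<open>(2, 1)\<close>, up to sign.\<close>

definition G2_coords :: "(real \<times> real) set" where
  "G2_coords = {(1, 0), (- 1, 0), (1, 2), (- 1, - 2), (0, 1), (0, - 1), (1, 1), (- 1, - 1),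
    (1, - 1), (- 1, 1), (2, 1), (- 2, - 1)}"

lemma G2_roots_eq:
  "G2_roots = (\<lambda>(x, y). x *\<^sub>R vector [1, - 1, 0] + y *\<^sub>R vector [0, 1, - 1]) ` G2_coords"
proof -
  have short: "{axis i 1 - axis j 1 | i j. i \<noteq> j} = {vector [1, - 1, 0], vector [- 1, 1, 0],
      vector [1, 0, - 1], vector [- 1, 0, 1], vector [0, 1, - 1], vector [0, - 1, 1] :: real^3}"
    by (auto simp: ex_3 axis_3_eq vector_3_arith)
  have long: "{s *\<^sub>R (axis i 2 - axis j 1 - axis k 1) | s i j k.
        s \<in> {-1, 1} \<and> i \<noteq> j \<and> i \<noteq> k \<and> j \<noteq> k} = {vector [2, - 1, - 1], vector [- 2, 1, 1],
      vector [- 1, 2, - 1], vector [1, - 2, 1], vector [- 1, - 1, 2], vector [1, 1, - 2] :: real^3}"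
    by (auto simp: ex_3 axis_3_eq vector_3_arith)
      ((rule exI[of _ 1], force) | (rule exI[of _ "- 1"], force))+
  show ?thesis
    unfolding G2_roots_def short long by (auto simp: G2_coords_def vector_3_arith)
qed

lemma is_orthogonal_sum_z_span:
  assumes "a \<bullet> b = 0"
  shows "is_orthogonal_sum (z_span {a, b}) (z_span {a}) (z_span {b})"
proof -
  have orth: "v \<bullet> w = 0" if "v \<in> z_span {a}" "w \<in> z_span {b}" for v w
    using that assms by (auto simp: z_span_singleton)
  then have "z_span {a} \<inter> z_span {b} \<subseteq> {0}" by (metis IntE inner_eq_zero_iff singletonI subsetI)
  moreover have "0 \<in> z_span {a} \<inter> z_span {b}" by (simp add: int_module.span_zero)
  ultimately show ?thesis
    unfolding is_orthogonal_sum_def using orth by (auto simp: z_span_pair z_span_singleton)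
qed

lemma z_span_eq_of_generators:
  assumes "B \<subseteq> S" "S \<subseteq> z_span B"
  shows "z_span S = z_span B"
  using assms int_module.span_superset[of S] by (auto simp: int_module.span_eq)

section \<open>Screeners in coordinates\<close>

lemma combination_inner_self:
  assumes "a \<bullet> a = of_int A" "a \<bullet> b = of_int B" "b \<bullet> b = of_int C"
  shows "(of_int x *\<^sub>R a + of_int y *\<^sub>R b) \<bullet> (of_int x *\<^sub>R a + of_int y *\<^sub>R b)
    = of_int (A * x\<^sup>2 + 2 * B * x * y + C * y\<^sup>2)"
  using assms by (simp add: inner_simps inner_commute[of b a] power2_eq_square algebra_simps)

lemma of_int_divide_Ints_iff:
  assumes "n \<noteq> 0"
  shows "of_int c / of_int n \<in> (\<int> :: real set) \<longleftrightarrow> n dvd c"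
proof
  assume "of_int c / of_int n \<in> (\<int> :: real set)"
  then obtain k where "of_int c / of_int n = (of_int k :: real)" by (rule Ints_cases)
  then have "of_int c = (of_int (k * n) :: real)" using assms by (simp add: field_simps)
  then show "n dvd c" using of_int_eq_iff by (metis dvd_triv_right)
qed (auto simp: assms)

text \<open>Uniqueness of coordinates turns membership in \<open>2L\<close> into a parity condition.
  The pairing is linear in the test vector, so membership in the dual lattice only has to be tested
  on \<open>a\<close> and \<open>b\<close>, where it says that the norm divides twice the inner
  product.\<close>

lemma screeners_z_span_pair:
  assumes D: "gram_det a b \<noteq> 0"
    and gram: "a \<bullet> a = of_int A" "a \<bullet> b = of_int B" "b \<bullet> b = of_int C"
  shows "of_int x *\<^sub>R a + of_int y *\<^sub>R b \<in> screeners (z_span {a, b}) \<longleftrightarrow>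
    even (A * x\<^sup>2 + 2 * B * x * y + C * y\<^sup>2) \<and> \<not> (even x \<and> even y) \<and>
    A * x\<^sup>2 + 2 * B * x * y + C * y\<^sup>2 dvd 2 * (A * x + B * y) \<and>
    A * x\<^sup>2 + 2 * B * x * y + C * y\<^sup>2 dvd 2 * (B * x + C * y)" (is "?v \<in> screeners ?L \<longleftrightarrow> ?rhs")
proof -
  define N where "N = A * x\<^sup>2 + 2 * B * x * y + C * y\<^sup>2"
  have norm: "?v \<bullet> ?v = of_int N"
    unfolding N_def by (rule combination_inner_self[OF gram])
  have "?v \<in> ?L" by (rule z_span_pairI)
  have "?v \<in> even_part ?L \<longleftrightarrow> (\<exists>k::int. (of_int N :: real) = of_int (2 * k))"
    using \<open>?v \<in> ?L\<close> norm by (simp add: even_part_def)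
  also have "\<dots> \<longleftrightarrow> even N" unfolding of_int_eq_iff by (auto simp: dvd_def)
  finally have even: "?v \<in> even_part ?L \<longleftrightarrow> even N" .
  have twice: "2 *\<^sub>R (of_int z *\<^sub>R a + of_int w *\<^sub>R b) = of_int (2 * z) *\<^sub>R a + of_int (2 * w) *\<^sub>R b" for z w
    by (simp add: scaleR_add_right)
  have "?v \<in> (\<lambda>x. 2 *\<^sub>R x) ` ?L \<longleftrightarrow>
      (\<exists>z w. ?v = of_int (2 * z) *\<^sub>R a + of_int (2 * w) *\<^sub>R b)" (is "_ = ?ex")
  proof
    assume "?v \<in> (\<lambda>x. 2 *\<^sub>R x) ` ?L"
    then obtain u where "u \<in> ?L" and v: "?v = 2 *\<^sub>R u" by blast
    from \<open>u \<in> ?L\<close> obtain z w where "u = of_int z *\<^sub>R a + of_int w *\<^sub>R b" by (rule z_span_pairE)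
    with v have "?v = of_int (2 * z) *\<^sub>R a + of_int (2 * w) *\<^sub>R b" by (simp only: twice)
    then show ?ex by blast
  next
    assume ?ex
    then obtain z w where "?v = of_int (2 * z) *\<^sub>R a + of_int (2 * w) *\<^sub>R b" by blast
    then show "?v \<in> (\<lambda>x. 2 *\<^sub>R x) ` ?L"
      unfolding twice[symmetric] using z_span_pairI by (rule image_eqI)
  qed
  also have "\<dots> \<longleftrightarrow> even x \<and> even y"
    unfolding gram_det_combination_eq_iff[OF D] of_int_eq_iff by (auto simp: dvd_def)
  finally have prim: "?v \<in> (\<lambda>x. 2 *\<^sub>R x) ` ?L \<longleftrightarrow> even x \<and> even y" .
  have dual: "(2 / (?v \<bullet> ?v)) *\<^sub>R ?v \<in> dual_lattice ?L \<longleftrightarrow>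
      N dvd 2 * (A * x + B * y) \<and> N dvd 2 * (B * x + C * y)" if "\<not> (even x \<and> even y)"
  proof -
    \<comment> \<open>Two even coordinates would include the zero vector; its exclusion makes
      division by the norm meaningful.\<close>
    have "?v \<noteq> 0" using gram_det_combination_eq_0[OF D, of "of_int x" "of_int y"] that by auto
    then have "N \<noteq> 0" using norm by (metis inner_eq_zero_iff of_int_0)
    have "2 / (?v \<bullet> ?v) = of_rat (2 / of_int N)" by (simp add: norm of_rat_divide)
    then have q: "(2 / (?v \<bullet> ?v)) *\<^sub>R ?v \<in> q_span ?L"
      using \<open>?v \<in> ?L\<close> rat_vector_space.span_scale rat_vector_space.span_base by metis
    have ip: "(of_int z *\<^sub>R a + of_int w *\<^sub>R b) \<bullet> ((2 / (?v \<bullet> ?v)) *\<^sub>R ?v)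
       = of_int (z * (2 * (A * x + B * y)) + w * (2 * (B * x + C * y))) / of_int N" for z w
      unfolding norm
      by (simp add: inner_simps gram inner_commute[of b a] add_divide_distrib algebra_simps)
    have "(2 / (?v \<bullet> ?v)) *\<^sub>R ?v \<in> dual_lattice ?L \<longleftrightarrow>
        (\<forall>z w. (of_int z *\<^sub>R a + of_int w *\<^sub>R b) \<bullet> ((2 / (?v \<bullet> ?v)) *\<^sub>R ?v) \<in> \<int>)"
      using q unfolding dual_lattice_def z_span_pair by blast
    also have "\<dots> \<longleftrightarrow> (\<forall>z w. N dvd z * (2 * (A * x + B * y)) + w * (2 * (B * x + C * y)))"
      unfolding ip of_int_divide_Ints_iff[OF \<open>N \<noteq> 0\<close>] ..
    also have "\<dots> \<longleftrightarrow> N dvd 2 * (A * x + B * y) \<and> N dvd 2 * (B * x + C * y)"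
    proof
      assume *: "\<forall>z w. N dvd z * (2 * (A * x + B * y)) + w * (2 * (B * x + C * y))"
      show "N dvd 2 * (A * x + B * y) \<and> N dvd 2 * (B * x + C * y)"
        using *[rule_format, of 1 0] *[rule_format, of 0 1] by simp
    qed simp
    finally show ?thesis .
  qed
  show ?thesis
    using even prim dual unfolding screeners_def N_def by blast
qed

text \<open>Only the entries of the Gram matrix enter, so finding the screeners becomes a
  divisibility problem for a binary quadratic form.\<close>

definition screener_coords :: "int \<Rightarrow> int \<Rightarrow> int \<Rightarrow> (int \<times> int) set" where
  "screener_coords A B C = {(x, y).
    even (A * x\<^sup>2 + 2 * B * x * y + C * y\<^sup>2) \<and> \<not> (even x \<and> even y) \<and>
    A * x\<^sup>2 + 2 * B * x * y + C * y\<^sup>2 dvd 2 * (A * x + B * y) \<and>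
    A * x\<^sup>2 + 2 * B * x * y + C * y\<^sup>2 dvd 2 * (B * x + C * y)}"

lemma screeners_eq_image_coords:
  assumes "gram_det a b \<noteq> 0"
    and "a \<bullet> a = of_int A" "a \<bullet> b = of_int B" "b \<bullet> b = of_int C"
  shows "screeners (z_span {a, b}) =
    (\<lambda>(x, y). of_int x *\<^sub>R a + of_int y *\<^sub>R b) ` screener_coords A B C" (is "_ = ?f ` _")
proof (intro subset_antisym subsetI)
  fix v assume v: "v \<in> screeners (z_span {a, b})"
  then have "v \<in> z_span {a, b}" by (simp add: screeners_def even_part_def)
  then obtain x y where "v = of_int x *\<^sub>R a + of_int y *\<^sub>R b" by (rule z_span_pairE)
  then show "v \<in> ?f ` screener_coords A B C"
    using v screeners_z_span_pair[OF assms] by (force simp: screener_coords_def)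
next
  fix v assume "v \<in> ?f ` screener_coords A B C"
  then show "v \<in> screeners (z_span {a, b})"
    using screeners_z_span_pair[OF assms] by (auto simp: screener_coords_def)
qed

lemma dvd_imp_abs_le_int:
  fixes n c :: int
  assumes "n dvd c" "c \<noteq> 0"
  shows "n \<le> \<bar>c\<bar>"
  using dvd_imp_le_int[OF assms(2,1)] abs_ge_self[of n] by (rule order_trans[rotated])

text \<open>Settles the candidates on an axis: for \<open>x\<close> times an axis vector, the
  screener condition gives this bound and primitivity modulo 2 makes \<open>x\<close> odd.\<close>

lemma odd_int_sq_le_2_abs:
  fixes x :: int
  assumes "odd x" "x\<^sup>2 \<le> 2 * \<bar>x\<bar>"
  shows "x = 1 \<or> x = - 1"
proof -
  have "x \<noteq> 0" using assms(1) by auto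
  have "\<bar>x\<bar> * \<bar>x\<bar> \<le> 2 * \<bar>x\<bar>" using assms(2) by (simp add: power2_eq_square flip: abs_mult)
  then have "\<bar>x\<bar> \<le> 2" using \<open>x \<noteq> 0\<close> mult_right_le_imp_le[of "\<bar>x\<bar>" "\<bar>x\<bar>" 2] by simp
  then have "x = -2 \<or> x = -1 \<or> x = 0 \<or> x = 1 \<or> x = 2" by linarith
  then show ?thesis using assms(1) by auto
qed

section \<open>Screeners of a rectangular cell\<close>

text \<open>Off the axes both terms of the norm are positive, so the two divisibility bounds become
  strict after one term is dropped and leave only \<open>\<bar>x\<bar> = \<bar>y\<bar> = 1\<close>.
  The parity of \<open>m\<close> matters because \<open>m\<close> is the norm of the second basis
  vector.\<close>

lemma screener_coords_rectangular:
  fixes p m :: int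
  assumes "p > 0" "m > 0" "m \<noteq> 2 * p"
  shows "screener_coords (2 * p) 0 m = {(1, 0), (- 1, 0)} \<union> (if even m then {(0, 1), (0, - 1)} else {})"
    (is "_ = ?S")
proof (rule subset_antisym, rule subrelI)
  fix x y assume "(x, y) \<in> screener_coords (2 * p) 0 m"
  then have xy: "even (m * y\<^sup>2)" "\<not> (even x \<and> even y)"
     "2 * p * x\<^sup>2 + m * y\<^sup>2 dvd 4 * p * x" "2 * p * x\<^sup>2 + m * y\<^sup>2 dvd 2 * m * y"
    by (auto simp: screener_coords_def mult.assoc)
  show "(x, y) \<in> ?S"
  proof (cases "x = 0 \<or> y = 0")
    case True
    then show ?thesis
    proof
      assume "x = 0"
      then have "y \<noteq> 0" "odd y" using xy(2) by auto
      then have "m * y\<^sup>2 \<le> m * (2 * \<bar>y\<bar>)"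
        using dvd_imp_abs_le_int[OF xy(4)] assms by (simp add: \<open>x = 0\<close> abs_mult)
      then have "y = 1 \<or> y = -1" using odd_int_sq_le_2_abs \<open>odd y\<close> \<open>m > 0\<close> by simp
      then show ?thesis using xy(1) \<open>x = 0\<close> by auto
    next
      assume "y = 0"
      then have "x \<noteq> 0" "odd x" using xy(2) by auto
      then have "p * x\<^sup>2 \<le> p * (2 * \<bar>x\<bar>)"
        using dvd_imp_abs_le_int[OF xy(3)] assms by (simp add: \<open>y = 0\<close> abs_mult)
      then have "x = 1 \<or> x = -1" using odd_int_sq_le_2_abs \<open>odd x\<close> \<open>p > 0\<close> by simp
      then show ?thesis using \<open>y = 0\<close> by auto
    qed
  next
    case False
    then have le: "2 * p * x\<^sup>2 + m * y\<^sup>2 \<le> 4 * p * \<bar>x\<bar>" "2 * p * x\<^sup>2 + m * y\<^sup>2 \<le> 2 * m * \<bar>y\<bar>"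
      using dvd_imp_abs_le_int[OF xy(3)] dvd_imp_abs_le_int[OF xy(4)] assms
      by (simp_all add: abs_mult)
    have pos: "m * y\<^sup>2 > 0" "p * x\<^sup>2 > 0" using False assms by simp_all
    have "(p * \<bar>x\<bar>) * \<bar>x\<bar> < (p * \<bar>x\<bar>) * 2" "(m * \<bar>y\<bar>) * \<bar>y\<bar> < (m * \<bar>y\<bar>) * 2"
      using le pos by (simp_all add: power2_eq_square mult.assoc flip: abs_mult)
    then have "\<bar>x\<bar> < 2" "\<bar>y\<bar> < 2"
      using assms mult_left_less_imp_less[of "p * \<bar>x\<bar>" "\<bar>x\<bar>" 2]
      mult_left_less_imp_less[of "m * \<bar>y\<bar>" "\<bar>y\<bar>" 2] by simp_all
    then have "\<bar>x\<bar> = 1" "\<bar>y\<bar> = 1" using False by auto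
    then have "x = 1 \<or> x = -1" "y = 1 \<or> y = -1" by linarith+
    then have "x\<^sup>2 = 1" "y\<^sup>2 = 1" by auto
    \<comment> \<open>The bounds now read \<open>2 * p + m \<le> 4 * p\<close> and
      \<open>2 * p + m \<le> 2 * m\<close>, which force the excluded value
      \<open>m = 2 * p\<close>.\<close>
    then show ?thesis using le \<open>\<bar>x\<bar> = 1\<close> \<open>\<bar>y\<bar> = 1\<close> assms by simp
  qed
next
  have "{(1, 0), (- 1, 0)} \<subseteq> screener_coords (2 * p) 0 m"
    by (simp add: screener_coords_def)
  moreover have "{(0, 1), (0, - 1)} \<subseteq> screener_coords (2 * p) 0 m" if "even m"
    using that by (simp add: screener_coords_def)
  ultimately show "?S \<subseteq> screener_coords (2 * p) 0 m"
    by (intro Un_least) (simp_all split: if_split del: insert_subset)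
qed

section \<open>Screeners of a rhombic cell\<close>

text \<open>
  Here \<open>X = 2 * x - y\<close> and \<open>Y = y\<close> are the coordinates of twice the vector \<open>x\<alpha>\<^sub>1 + y\<alpha>\<^sub>2\<close> along
  \<open>\<alpha>\<^sub>1\<close> and \<open>\<alpha>\<^sub>1 + 2\<alpha>\<^sub>2\<close>, whose norms are \<open>2 * p\<close> and \<open>2 * q\<close> with \<open>q = 2 * m - p\<close>.
\<close>

lemma rhombic_screener_diagonal_coords:
  fixes p q X Y :: int
  assumes "p > 0" "q \<ge> p" "X \<noteq> 0" "Y \<noteq> 0" and parity: "even X = even Y"
    and dvd: "p * X\<^sup>2 + q * Y\<^sup>2 dvd 4 * p * X" "p * X\<^sup>2 + q * Y\<^sup>2 dvd 4 * q * Y"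
  shows "(\<bar>X\<bar> = 1 \<and> \<bar>Y\<bar> = 1 \<and> (q = p \<or> q = 3 * p)) \<or> (\<bar>X\<bar> = 3 \<and> \<bar>Y\<bar> = 1 \<and> q = 3 * p) \<or> (\<bar>X\<bar> = 2 \<and> \<bar>Y\<bar> = 2 \<and> q = p)"
proof -
  have "q > 0" using assms(1,2) by linarith
  have "4 * p * \<bar>X\<bar> = \<bar>4 * p * X\<bar>" using \<open>p > 0\<close> by (simp add: abs_mult)
  then have dvd': "p * \<bar>X\<bar>\<^sup>2 + q * \<bar>Y\<bar>\<^sup>2 dvd 4 * p * \<bar>X\<bar>"
    using dvd(1) by (simp only: dvd_abs_iff power2_abs)
  have le: "p * \<bar>X\<bar>\<^sup>2 + q * \<bar>Y\<bar>\<^sup>2 \<le> 4 * p * \<bar>X\<bar>" "p * \<bar>X\<bar>\<^sup>2 + q * \<bar>Y\<bar>\<^sup>2 \<le> 4 * q * \<bar>Y\<bar>"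
    using dvd_imp_abs_le_int[OF dvd(1)] dvd_imp_abs_le_int[OF dvd(2)] assms(1-4) \<open>q > 0\<close>
    by (simp_all add: abs_mult)
  have pos: "p * \<bar>X\<bar>\<^sup>2 > 0" "q * \<bar>Y\<bar>\<^sup>2 > 0" using assms(1-4) \<open>q > 0\<close> by simp_all
  have "(p * \<bar>X\<bar>) * \<bar>X\<bar> < (p * \<bar>X\<bar>) * 4" "(q * \<bar>Y\<bar>) * \<bar>Y\<bar> < (q * \<bar>Y\<bar>) * 4"
    using le pos by (simp_all add: power2_eq_square mult.assoc)
  then have "\<bar>X\<bar> < 4" "\<bar>Y\<bar> < 4"
    using assms(1-4) \<open>q > 0\<close> mult_left_less_imp_less[of "p * \<bar>X\<bar>" "\<bar>X\<bar>" 4]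
      mult_left_less_imp_less[of "q * \<bar>Y\<bar>" "\<bar>Y\<bar>" 4] by simp_all
  then have "\<bar>X\<bar> = 1 \<or> \<bar>X\<bar> = 2 \<or> \<bar>X\<bar> = 3" "\<bar>Y\<bar> = 1 \<or> \<bar>Y\<bar> = 2 \<or> \<bar>Y\<bar> = 3"
    using assms(1-4) by linarith+
  moreover have "even \<bar>X\<bar> = even \<bar>Y\<bar>" using parity by simp
  \<comment> \<open>Equal parity leaves five of the nine pairs of absolute values.\<close>
  ultimately consider "\<bar>X\<bar> = 1" "\<bar>Y\<bar> = 1" | "\<bar>X\<bar> = 3" "\<bar>Y\<bar> = 1" | "\<bar>X\<bar> = 2" "\<bar>Y\<bar> = 2" | "\<bar>X\<bar> = 1" "\<bar>Y\<bar> = 3" | "\<bar>X\<bar> = 3" "\<bar>Y\<bar> = 3"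
    by (elim disjE) auto
  then show ?thesis
  proof cases
    case 1
    then have "p + q dvd 4 * p" using dvd' by simp
    then obtain k where k: "4 * p = (p + q) * k" by (auto simp: dvd_def)
    have "k > 0" using  assms(1) \<open>q > 0\<close> zero_less_mult_pos[of "p + q" k] by (simp flip: k)
    \<comment> \<open>Since \<open>p + q \<ge> 2 * p\<close>, the quotient \<open>k\<close> is at
      most 2; \<open>k = 1\<close> gives \<open>q = 3 * p\<close> and \<open>k = 2\<close> gives
      \<open>q = p\<close>.\<close>
    have "2 * p * k \<le> 2 * p * 2" using k assms(1,2) mult_right_mono[of "2 * p" "p + q" k] \<open>k > 0\<close> by simp
    then have "k = 1 \<or> k = 2" using \<open>k > 0\<close> assms(1) by auto
    then show ?thesis using k 1 by auto
  next
    case 2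
    then have "9 * p + q dvd 12 * p" using dvd' by (simp add: mult.commute)
    then obtain k where k: "12 * p = (9 * p + q) * k" by (auto simp: dvd_def)
    have "k > 0" using  assms(1) \<open>q > 0\<close> zero_less_mult_pos[of "9 * p + q" k] by (simp flip: k)
    \<comment> \<open>Since \<open>9 * p + q \<ge> 10 * p\<close>, the quotient can only be 1, which
      means \<open>q = 3 * p\<close>.\<close>
    have "10 * p * k \<le> 12 * p" using k assms(1,2) mult_right_mono[of "10 * p" "9 * p + q" k] \<open>k > 0\<close> by simp
    then have "p * (10 * k) \<le> p * 12" by simp
    then have "k = 1" using \<open>k > 0\<close> assms(1) by simp
    then show ?thesis using k 2 by auto
  next
    case 3
    then have "q = p" using le(1) assms(2) by simp
    then show ?thesis using 3 by blast
  next
    case 4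
    then have "p + 9 * q \<le> 4 * p" using le(1) by simp
    then show ?thesis using assms(1,2) by linarith
  next
    case 5
    then have "9 * p + 9 * q \<le> 12 * p" using le(1) by simp
    then show ?thesis using assms(1,2) by linarith
  qed
qed

text \<open>In the diagonal coordinates \<open>X = 2 * x - y\<close> and \<open>y\<close> the form
  has no mixed term. A zero coordinate means a multiple of a diagonal; otherwise
  \<open>rhombic_screener_diagonal_coords\<close> leaves a finite list.\<close>

lemma screener_coords_rhombic_subset:
  fixes p m x y :: int
  assumes "p > 0" "m \<ge> p" and "(x, y) \<in> screener_coords (2 * p) (- p) m"
  shows "(x, y) \<in> {(1, 0), (- 1, 0), (1, 2), (- 1, - 2)} \<or>
    (m = p \<and> even p \<or> m = 2 * p) \<and> (x, y) \<in> {(0, 1), (0, - 1), (1, 1), (- 1, - 1)} \<or>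
    m = 2 * p \<and> (x, y) \<in> {(1, - 1), (- 1, 1), (2, 1), (- 2, - 1)}"
proof -
  define N where "N = 2 * p * x\<^sup>2 + 2 * (- p) * x * y + m * y\<^sup>2"
  define q where "q = 2 * m - p"
  define X where "X = 2 * x - y"
  have coords: "even N" "\<not> (even x \<and> even y)" "N dvd 2 * (2 * p * x + - p * y)" "N dvd 2 * (- p * x + m * y)"
    using assms(3) unfolding screener_coords_def mem_Collect_eq prod.case N_def by blast+
  have N2: "2 * N = p * X\<^sup>2 + q * y\<^sup>2"
    by (simp add: N_def q_def X_def power2_eq_square algebra_simps)
  have dX: "N dvd 2 * p * X" using coords(3) by (simp add: X_def algebra_simps)
  \<comment> \<open>The inner product with the diagonal \<open>\<alpha>1 + 2\<alpha>2\<close> is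
    \<open>q * y\<close>, so adding the first divisibility to twice the second isolates
    \<open>y\<close>.\<close>
  have "2 * q * y = 2 * (2 * p * x + - p * y) + 2 * (2 * (- p * x + m * y))"
    by (simp add: q_def algebra_simps)
  then have dY: "N dvd 2 * q * y"
    using dvd_add[OF coords(3) dvd_mult[OF coords(4), of 2]] by (simp only:)
  have d2: "p * X\<^sup>2 + q * y\<^sup>2 dvd 4 * p * X" "p * X\<^sup>2 + q * y\<^sup>2 dvd 4 * q * y"
    using dX dY mult_dvd_mono[of 2 2 N] unfolding N2[symmetric] by (fastforce simp: mult.assoc)+
  have q: "q \<ge> p" "q > 0" using assms q_def by auto
  have "even X = even y" by (simp add: X_def)
  consider "y = 0" | "X = 0" | "X \<noteq> 0" "y \<noteq> 0" by blast
  then show ?thesis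
  proof cases
    case 1
    then have "odd x" "x \<noteq> 0" using coords(2) by auto
    then have "p * x\<^sup>2 \<le> p * (2 * \<bar>x\<bar>)"
      using dvd_imp_abs_le_int[OF dX] assms 1 by (simp add: abs_mult N_def X_def)
    then have "x = 1 \<or> x = -1" using odd_int_sq_le_2_abs \<open>odd x\<close> assms by simp
    then show ?thesis using 1 by auto
  next
    case 2
    then have y: "y = 2 * x" by (simp add: X_def)
    then have "odd x" "x \<noteq> 0" using coords(2) by auto
    have "N = 2 * q * x\<^sup>2" using N2 2 y by (simp add: power2_eq_square)
    then have "q * x\<^sup>2 \<le> q * (2 * \<bar>x\<bar>)"
      using dvd_imp_abs_le_int[OF dY] q y \<open>x \<noteq> 0\<close> by (simp add: abs_mult)
    then have "x = 1 \<or> x = -1" using odd_int_sq_le_2_abs \<open>odd x\<close> q by simp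
    then show ?thesis using y by auto
  next
    case 3
    have x: "2 * x = X + y" by (simp add: X_def)
    have "q = p \<longleftrightarrow> m = p" "q = 3 * p \<longleftrightarrow> m = 2 * p" by (auto simp: q_def)
    then have "(\<bar>X\<bar> = 1 \<and> \<bar>y\<bar> = 1 \<and> (m = p \<or> m = 2 * p)) \<or> (\<bar>X\<bar> = 3 \<and> \<bar>y\<bar> = 1 \<and> m = 2 * p)
        \<or> (\<bar>X\<bar> = 2 \<and> \<bar>y\<bar> = 2 \<and> m = p)"
      using rhombic_screener_diagonal_coords[OF assms(1) q(1) 3 \<open>even X = even y\<close> d2] by blast
    moreover have abs: "\<bar>z\<bar> = c \<Longrightarrow> z = c \<or> z = - c" for z c :: int by linarith
    ultimately consider
        "X = 1 \<or> X = -1" "y = 1 \<or> y = -1" "m = p \<or> m = 2 * p"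
      | "X = 3 \<or> X = -3" "y = 1 \<or> y = -1" "m = 2 * p"
      | "X = 2 \<or> X = -2" "y = 2 \<or> y = -2"
      by blast
    then show ?thesis
    proof cases
      case 1
      then have xy: "(x, y) \<in> {(0, 1), (0, - 1), (1, 1), (- 1, - 1)}" using x by (elim disjE) simp_all
      \<comment> \<open>For \<open>m = p\<close> these four vectors have norm \<open>p\<close>, so
        lying in the even part forces \<open>p\<close> to be even; for \<open>m = 2 * p\<close>
        their norm is \<open>2 * p\<close>.\<close>
      then have "even p" if "m = p" using coords(1) that unfolding N_def by auto
      with 1(3) have "m = p \<and> even p \<or> m = 2 * p" by blast
      then show ?thesis using xy by (simp only: simp_thms)
    next
      case 2
      then have "(x, y) \<in> {(1, - 1), (- 1, 1), (2, 1), (- 2, - 1)}" using x by (elim disjE) simp_all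
      then show ?thesis using 2(3) by blast
    next
      case 3
      \<comment> \<open>With \<open>X\<close> and \<open>y\<close> both \<open>2\<close> up to sign,
        \<open>x\<close> is half their sum, so the vector lies in \<open>2L\<close>.\<close>
      then have "even x \<and> even y" using x by (elim disjE) auto
      then show ?thesis using coords(2) by blast
    qed
  qed
qed

lemma screener_coords_rhombic:
  fixes p m :: int
  assumes "p > 0" "m \<ge> p"
  shows "screener_coords (2 * p) (- p) m = {(1, 0), (- 1, 0), (1, 2), (- 1, - 2)} \<union>
    (if m = p \<and> even p \<or> m = 2 * p then {(0, 1), (0, - 1), (1, 1), (- 1, - 1)} else {}) \<union>
    (if m = 2 * p then {(1, - 1), (- 1, 1), (2, 1), (- 2, - 1)} else {})" (is "_ = ?S")
proof (rule subset_antisym, rule subrelI)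
  have mem: "z \<in> S \<union> (if P then T else {}) \<union> (if Q then U else {})"
    if "z \<in> S \<or> P \<and> z \<in> T \<or> Q \<and> z \<in> U" for z :: "int \<times> int" and S T U P Q
    using that by auto
  fix x y assume "(x, y) \<in> screener_coords (2 * p) (- p) m"
  then show "(x, y) \<in> ?S" by (rule mem[OF screener_coords_rhombic_subset[OF assms]])
next
  \<comment> \<open>The norm of \<open>\<alpha>1 + 2\<alpha>2\<close> is
    \<open>4 * m - 2 * p\<close>; the right-hand side with reversed sign occurs for the negative of
    this vector.\<close>
  have "4 * m - 2 * p dvd 2 * p - 4 * m" by (rule dvdI[of _ _ "- 1"]) simp
  then have "{(1, 0), (- 1, 0), (1, 2), (- 1, - 2)} \<subseteq> screener_coords (2 * p) (- p) m"
    by (simp add: screener_coords_def mult.commute[of m])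
  moreover have "{(0, 1), (0, - 1), (1, 1), (- 1, - 1)} \<subseteq> screener_coords (2 * p) (- p) m"
    if "m = p \<and> even p \<or> m = 2 * p"
    using that by (elim disjE conjE) (simp_all add: screener_coords_def)
  moreover have "{(1, - 1), (- 1, 1), (2, 1), (- 2, - 1)} \<subseteq> screener_coords (2 * p) (- p) m"
    if "m = 2 * p"
    unfolding that by (simp add: screener_coords_def)
  ultimately show "?S \<subseteq> screener_coords (2 * p) (- p) m"
    by (intro Un_least) (simp_all split: if_split del: insert_subset)
qed

section \<open>Bases of the two types\<close>

lemma gram_eq_iff:
  "gram a b = vector [vector [A, B], vector [B, D]] \<longleftrightarrow> a \<bullet> a = A \<and> a \<bullet> b = B \<and> b \<bullet> b = D"
  by (auto simp: gram_def vec_eq_iff forall_2 vector_2 inner_commute)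

lemma type1_basis_iff:
  "type1_basis L p m a1 a2 \<longleftrightarrow> L = z_span {a1, a2} \<and> p > 0 \<and> m > 0 \<and> m \<noteq> 2 * p \<and>
    a1 \<bullet> a1 = of_int (2 * p) \<and> a1 \<bullet> a2 = of_int 0 \<and> a2 \<bullet> a2 = of_int m"
proof -
  have "a1 \<noteq> a2 \<and> \<not> z_dependent {a1, a2}"
    if "p > 0" "m > 0" "a1 \<bullet> a1 = of_int (2 * p)" "a1 \<bullet> a2 = of_int 0" "a2 \<bullet> a2 = of_int m"
    using that by (subst independent_pair_iff) (auto simp: gram_det_def)
  then show ?thesis
    unfolding type1_basis_def z_basis_def gram_eq_iff of_int_0 by blast
qed

lemma gram_det_type1:
  assumes "type1_basis L p m a1 a2"
  shows "gram_det a1 a2 \<noteq> 0"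
  using assms unfolding type1_basis_iff gram_det_def by simp

lemma rhombic_gram_det_pos:
  fixes p m :: int
  assumes "p > 0" "m \<ge> p" "a1 \<bullet> a1 = of_int (2 * p)" "a1 \<bullet> a2 = of_int (- p)" "a2 \<bullet> a2 = of_int m"
  shows "gram_det a1 a2 \<noteq> 0"
proof -
  have "gram_det a1 a2 = of_int (p * (2 * m - p))"
    unfolding gram_det_def assms(3-5) by (simp add: power2_eq_square algebra_simps)
  then show ?thesis using assms(1,2) by auto
qed

lemma type2_basis_iff:
  "type2_basis L p m a1 a2 \<longleftrightarrow> L = z_span {a1, a2} \<and> p > 0 \<and> m \<ge> p \<and>
    a1 \<bullet> a1 = of_int (2 * p) \<and> a1 \<bullet> a2 = of_int (- p) \<and> a2 \<bullet> a2 = of_int m"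
proof -
  have "a1 \<noteq> a2 \<and> \<not> z_dependent {a1, a2}"
    if "p > 0" "m \<ge> p" "a1 \<bullet> a1 = of_int (2 * p)" "a1 \<bullet> a2 = of_int (- p)" "a2 \<bullet> a2 = of_int m"
    using rhombic_gram_det_pos[OF that] that independent_pair_iff[of a1 a2] by (metis Ints_of_int)
  then show ?thesis
    unfolding type2_basis_def z_basis_def gram_eq_iff of_int_minus by blast
qed

lemma gram_det_type2:
  assumes "type2_basis L p m a1 a2"
  shows "gram_det a1 a2 \<noteq> 0"
  using assms rhombic_gram_det_pos[of p m a1 a2] unfolding type2_basis_iff by blast

section \<open>Existence of a basis of one of the two types\<close>

lemma exists_type_of_orthogonal:
  assumes "b \<bullet> b = of_int (2 * p)" "b \<bullet> c = 0" "c \<bullet> c = of_int m" "p > 0" "m > 0"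
  shows "\<exists>p m a1 a2. type1_basis (z_span {b, c}) p m a1 a2 \<or> type2_basis (z_span {b, c}) p m a1 a2"
proof (cases "m = 2 * p")
  case False
  then have "type1_basis (z_span {b, c}) p m b c" using assms by (simp add: type1_basis_iff)
  then show ?thesis by blast
next
  case True
  \<comment> \<open>A diagonal and a side of the square: the norms are \<open>4 * p\<close> and
    \<open>2 * p\<close> and the inner product is \<open>- 2 * p\<close>. The type 2 parameter is
    therefore \<open>2 * p\<close>, equal to \<open>m\<close>.\<close>
  have "z_span {b - c, c} = z_span {b, c}" using z_span_unimodular[of 1 1 "- 1" 0 b c] by simp
  then have "type2_basis (z_span {b, c}) (2 * p) m (b - c) c"
    using assms True by (simp add: type2_basis_iff inner_simps inner_commute[of c b])
  then show ?thesis by blast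
qed

lemma exists_type2_of_rhombic:
  assumes "b \<bullet> b = of_int (2 * p)" "b \<bullet> c = - of_int p" "c \<bullet> c = of_int m" "p > 0" "2 * m > p"
  shows "\<exists>p m a1 a2. type2_basis (z_span {b, c}) p m a1 a2"
proof (cases "m \<ge> p")
  case True
  then have "type2_basis (z_span {b, c}) p m b c" using assms by (simp add: type2_basis_iff)
  then show ?thesis by blast
next
  case False
  \<comment> \<open>The other diagonal \<open>b + 2c\<close> takes the role of the first vector. The
    companion \<open>- b - c\<close> is chosen so that the new second diagonal is
    \<open>- b\<close>; the parameter becomes \<open>2 * m - p\<close>, which is below
    \<open>m\<close> because \<open>m < p\<close>.\<close>
  have "z_span {b + 2 *\<^sub>R c, - b - c} = z_span {b, c}"
    using z_span_unimodular[of 1 "- 1" 2 "- 1" b c] by simp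
  moreover have "(b + 2 *\<^sub>R c) \<bullet> (b + 2 *\<^sub>R c) = of_int (2 * (2 * m - p))"
    "(b + 2 *\<^sub>R c) \<bullet> (- b - c) = of_int (- (2 * m - p))" "(- b - c) \<bullet> (- b - c) = of_int m"
    using assms(1-3) by (simp_all add: inner_simps inner_commute[of c b])
  ultimately have "type2_basis (z_span {b, c}) (2 * m - p) m (b + 2 *\<^sub>R c) (- b - c)"
    using assms(5) False unfolding type2_basis_iff by simp
  then show ?thesis by blast
qed

text \<open>The reflection in \<open>b\<close> sends \<open>c\<close> to \<open>c - j b\<close>.
  Adding multiples of \<open>b\<close> to \<open>c\<close> changes \<open>j\<close> by even amounts,
  so only its parity decides between the orthogonal and the rhombic case.\<close>

lemma exists_type_of_reflection:
  assumes D: "gram_det b c \<noteq> 0"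
    and b: "b \<bullet> b = of_int (2 * p)" and bc: "b \<bullet> c = of_int (p * j)" and c: "c \<bullet> c = of_int M"
  shows "\<exists>p m a1 a2. type1_basis (z_span {b, c}) p m a1 a2 \<or> type2_basis (z_span {b, c}) p m a1 a2"
proof -
  \<comment> \<open>Rounding up makes \<open>j - 2 * n\<close> equal to \<open>0\<close> for even
    \<open>j\<close> and \<open>- 1\<close> for odd \<open>j\<close>, the sign required in type
    2.\<close>
  define n where "n = (j + 1) div 2"
  define d where "d = of_int (- n) *\<^sub>R b + of_int 1 *\<^sub>R c"
  define m where "m = 2 * p * n\<^sup>2 - 2 * n * p * j + M"
  have span: "z_span {b, d} = z_span {b, c}"
    using z_span_unimodular[of 1 1 0 "- n" b c] by (simp add: d_def)
  have "gram_det b d \<noteq> 0" by (rule gram_det_nonzero_z_span[OF span[symmetric] D])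
  then have pos: "gram_det b d > 0" using gram_det_nonneg[of b d] by linarith
  then have "b \<noteq> 0" "d \<noteq> 0" by (auto simp: gram_det_def)
  have "p > 0" using \<open>b \<noteq> 0\<close> b by (metis inner_gt_zero_iff of_int_0_less_iff zero_less_mult_pos zero_less_numeral)
  have bd: "b \<bullet> d = of_int (p * (j - 2 * n))"
    unfolding d_def by (simp add: inner_simps b bc algebra_simps)
  have d: "d \<bullet> d = of_int m"
    unfolding d_def m_def
    by (simp add: inner_simps b bc c inner_commute[of c b] power2_eq_square algebra_simps)
  show ?thesis
  proof (cases "even j")
    case True
    then have "j = 2 * n" unfolding n_def by presburger
    then have "b \<bullet> d = 0" using bd by simp
    moreover have "m > 0" using \<open>d \<noteq> 0\<close> d by (metis inner_gt_zero_iff of_int_0_less_iff)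
    ultimately show ?thesis
      using exists_type_of_orthogonal[of b p d m] b d \<open>p > 0\<close> unfolding span by blast
  next
    case False
    then have "j - 2 * n = - 1" unfolding n_def by presburger
    then have "b \<bullet> d = - of_int p" using bd by simp
    \<comment> \<open>Positivity of the determinant is exactly the bound \<open>2 * m > p\<close>
      needed for the exchange of diagonals.\<close>
    moreover from this have "gram_det b d = of_int (p * (2 * m - p))"
      unfolding gram_det_def b d by (simp add: power2_eq_square algebra_simps)
    then have "p * (2 * m - p) > 0" using pos by (simp only: of_int_0_less_iff)
    then have "2 * m > p" using \<open>p > 0\<close> by (simp add: zero_less_mult_iff)
    ultimately show ?thesis
      using exists_type2_of_rhombic[of b p d m] b d \<open>p > 0\<close> unfolding span by blast
  qed
qed

lemma exists_type_of_screener: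
  assumes D: "gram_det u v \<noteq> 0"
    and gram: "u \<bullet> u = of_int A" "u \<bullet> v = of_int B" "v \<bullet> v = of_int C"
    and "screeners (z_span {u, v}) \<noteq> {}"
  shows "\<exists>p m a1 a2. type1_basis (z_span {u, v}) p m a1 a2 \<or> type2_basis (z_span {u, v}) p m a1 a2"
proof -
  obtain x y where "(x, y) \<in> screener_coords A B C"
    using assms(5) unfolding screeners_eq_image_coords[OF D gram] by auto
  define N where "N = A * x\<^sup>2 + 2 * B * x * y + C * y\<^sup>2"
  have xy: "even N" "\<not> (even x \<and> even y)" "N dvd 2 * (A * x + B * y)" "N dvd 2 * (B * x + C * y)"
    using \<open>(x, y) \<in> screener_coords A B C\<close>
    unfolding screener_coords_def mem_Collect_eq prod.case N_def by blast+
  define b where "b = of_int x *\<^sub>R u + of_int y *\<^sub>R v"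
  have b: "b \<bullet> b = of_int N"
    unfolding b_def N_def by (rule combination_inner_self[OF gram])
  have "b \<noteq> 0" using gram_det_combination_eq_0[OF D, of "of_int x" "of_int y"] xy(2)
    by (auto simp: b_def)
  then have "N \<noteq> 0" using b by auto
  \<comment> \<open>The norm of \<open>b\<close> divides twice the inner product of \<open>b\<close>
    with \<open>b / g\<close>, where \<open>g\<close> is the gcd of its coordinates. Hence
    \<open>g\<close> divides 2, and \<open>g = 2\<close> would put \<open>b\<close> in
    \<open>2L\<close>.\<close>
  have "coprime x y"
  proof -
    define g where "g = gcd x y"
    obtain x' y' where x: "x = g * x'" and y: "y = g * y'" unfolding g_def by (meson dvdE gcd_dvd1 gcd_dvd2)
    define N' where "N' = A * x'\<^sup>2 + 2 * B * x' * y' + C * y'\<^sup>2"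
    have N': "N = g * g * N'" by (simp add: N_def N'_def x y power2_eq_square algebra_simps)
    have "N dvd x' * (2 * (A * x + B * y)) + y' * (2 * (B * x + C * y))"
      by (rule dvd_add[OF dvd_mult[OF xy(3)] dvd_mult[OF xy(4)]])
    also have "\<dots> = g * N' * 2" by (simp add: N'_def x y power2_eq_square algebra_simps)
    finally have "(g * N') * g dvd (g * N') * 2" by (simp add: N' mult_ac)
    then have "g dvd 2" using \<open>N \<noteq> 0\<close> N' by (subst (asm) dvd_mult_cancel_left) auto
    then have "g \<le> 2" "g \<ge> 0" by (auto simp: g_def zdvd_imp_le)
    moreover have "g \<noteq> 2" "g \<noteq> 0" using xy(2) x y by auto
    ultimately have "g = 1" by linarith
    then show ?thesis by (simp add: g_def coprime_iff_gcd_eq_1)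
  qed
  \<comment> \<open>Bezout coefficients give a second vector \<open>c\<close> such that the change
    of basis has determinant \<open>s * x + t * y = 1\<close>.\<close>
  obtain s t where st: "s * x + t * y = 1"
    using bezout_int[of x y] \<open>coprime x y\<close> by (auto simp: coprime_iff_gcd_eq_1)
  define c where "c = of_int (- t) *\<^sub>R u + of_int s *\<^sub>R v"
  have span: "z_span {b, c} = z_span {u, v}"
    unfolding b_def c_def by (rule z_span_unimodular) (use st in \<open>simp add: algebra_simps\<close>)
  define k where "k = - t * (A * x + B * y) + s * (B * x + C * y)"
  have bc: "b \<bullet> c = of_int k"
    unfolding b_def c_def k_def
    by (simp add: inner_simps gram inner_commute[of v u] algebra_simps)
  have "N dvd - t * (2 * (A * x + B * y)) + s * (2 * (B * x + C * y))"
    by (rule dvd_add[OF dvd_mult[OF xy(3)] dvd_mult[OF xy(4)]])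
  also have "\<dots> = 2 * k" by (simp add: k_def algebra_simps)
  finally have "N dvd 2 * k" .
  obtain p where p: "N = 2 * p" using xy(1) by (auto elim: evenE)
  then obtain j where "k = p * j" using \<open>N dvd 2 * k\<close> by (auto simp: dvd_def)
  then have "b \<bullet> c = of_int (p * j)" "b \<bullet> b = of_int (2 * p)" using b bc p by simp_all
  moreover have "gram_det b c \<noteq> 0" by (rule gram_det_nonzero_z_span[OF span[symmetric] D])
  ultimately show ?thesis
    using exists_type_of_reflection combination_inner_self[OF gram, of "- t" s] unfolding span[symmetric] c_def by blast
qed

section \<open>Lattices generated by two vectors of equal norm\<close>

text \<open>Such generators are sides of a rhombus, and a diagonal with a side is the required
  basis. The shorter diagonal is taken: its parameter \<open>n - \<bar>k\<bar>\<close> is at most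
  \<open>n\<close>, and it is positive by strict Cauchy-Schwarz.\<close>

lemma exists_type2_of_equal_norms:
  assumes D: "gram_det u v \<noteq> 0"
    and gram: "u \<bullet> u = of_int n" "u \<bullet> v = of_int k" "v \<bullet> v = of_int n"
  shows "\<exists>p m a1 a2. type2_basis (z_span {u, v}) p m a1 a2"
proof -
  have "gram_det u v > 0" using D gram_det_nonneg[of u v] by linarith
  then have "of_int (k * k) < (of_int (n * n) :: real)" by (simp add: gram_det_def gram power2_eq_square)
  then have "k * k < n * n" by (simp only: of_int_less_iff)
  moreover have "n \<ge> 0" using gram(1) inner_ge_zero[of u] by simp
  ultimately have less: "\<bar>k\<bar> < n" using abs_le_square_iff[of n k] by (simp add: power2_eq_square)
  show ?thesis
  proof (cases "k \<ge> 0")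
    case True
    have "z_span {u - v, v} = z_span {u, v}" using z_span_unimodular[of 1 1 "- 1" 0 u v] by simp
    then have "type2_basis (z_span {u, v}) (n - k) n (u - v) v"
      using less True gram by (simp add: type2_basis_iff inner_simps inner_commute[of v u])
    then show ?thesis by blast
  next
    case False
    have "z_span {u + v, - u} = z_span {u, v}" using z_span_unimodular[of 1 0 1 "- 1" u v] by simp
    then have "type2_basis (z_span {u, v}) (n + k) n (u + v) (- u)"
      using less False gram by (simp add: type2_basis_iff inner_simps inner_commute[of v u])
    then show ?thesis by blast
  qed
qed

text \<open>The reflection in \<open>a1\<close> exchanges \<open>a2\<close> and
  \<open>a1 + a2\<close>, so these generators have equal norm.\<close>

lemma exists_equal_norms_of_type2:
  assumes "type2_basis L p m a1 a2"
  shows "z_span {a1 + a2, a2} = L \<and> (a1 + a2) \<bullet> (a1 + a2) = a2 \<bullet> a2"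
  using assms z_span_unimodular[of 1 1 1 0 a1 a2]
  by (simp add: type2_basis_iff inner_simps inner_commute[of a2 a1])

section \<open>Classification of the screeners\<close>

text \<open>The norm of \<open>x a1 + y a2\<close> is congruent to \<open>m * y^2\<close> modulo 2,
  since its other two coefficients are multiples of \<open>2 * p\<close>.\<close>

lemma even_lattice_type2_iff:
  assumes "integral_lattice L" "type2_basis L p m a1 a2"
  shows "even_lattice L \<longleftrightarrow> even m"
proof
  have L: "L = z_span {a1, a2}" and gram: "a1 \<bullet> a1 = of_int (2 * p)" "a1 \<bullet> a2 = of_int (- p)" "a2 \<bullet> a2 = of_int m"
    using assms(2) by (auto simp: type2_basis_iff)
  {
    assume "even_lattice L"
    moreover have "a2 \<in> L" unfolding L by (simp add: int_module.span_base)
    ultimately obtain k :: int where "a2 \<bullet> a2 = 2 * of_int k" unfolding even_lattice_def by blast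
    then have "(of_int m :: real) = of_int (2 * k)" using gram by simp
    then have "m = 2 * k" by (simp only: of_int_eq_iff)
    then show "even m" by simp
  next
    assume "even m"
    then obtain l where l: "m = 2 * l" by (rule evenE)
    have "\<exists>k::int. w \<bullet> w = 2 * of_int k" if "w \<in> L" for w
    proof -
      obtain x y where w: "w = of_int x *\<^sub>R a1 + of_int y *\<^sub>R a2"
        using \<open>w \<in> L\<close> unfolding L by (rule z_span_pairE)
      have "w \<bullet> w = 2 * of_int (p * x\<^sup>2 - p * x * y + l * y\<^sup>2)"
        unfolding w combination_inner_self[OF gram] by (simp add: l)
      then show ?thesis by blast
    qed
    then show "even_lattice L" using assms(1) by (simp add: even_lattice_def)
  }
qed

lemma screeners_type1:
  assumes "type1_basis L p m a1 a2"
  shows "screeners L = (if even m then {a1, - a1, a2, - a2} else {a1, - a1})"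
proof -
  have "p > 0" "m > 0" "m \<noteq> 2 * p" using assms by (auto simp: type1_basis_iff)
  from screener_coords_rectangular[OF this] show ?thesis
    using assms screeners_eq_image_coords[OF gram_det_type1[OF assms], of "2 * p" 0 m]
    by (auto simp: type1_basis_iff)
qed

lemma screeners_type2:
  assumes "type2_basis L p m a1 a2"
  shows "screeners L = Phi_bar a1 a2 \<union>
    (if m = p \<and> even p \<or> m = 2 * p then {a2, - a2, a1 + a2, - (a1 + a2)} else {}) \<union>
    (if m = 2 * p then {a1 - a2, - (a1 - a2), 2 *\<^sub>R a1 + a2, - (2 *\<^sub>R a1 + a2)} else {})"
proof -
  let ?f = "\<lambda>(x, y). of_int x *\<^sub>R a1 + of_int y *\<^sub>R a2"
  have "p > 0" "m \<ge> p" using assms by (auto simp: type2_basis_iff)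
  note coords = screener_coords_rhombic[OF this]
  have neg: "of_int (- 1) *\<^sub>R a1 + of_int (- 2) *\<^sub>R a2 = - (a1 + 2 *\<^sub>R a2)"
    "of_int (- 1) *\<^sub>R a1 + of_int (- 1) *\<^sub>R a2 = - (a1 + a2)"
    "of_int (- 1) *\<^sub>R a1 + of_int 1 *\<^sub>R a2 = - (a1 - a2)"
    "of_int (- 2) *\<^sub>R a1 + of_int (- 1) *\<^sub>R a2 = - (2 *\<^sub>R a1 + a2)" by simp_all
  have "screeners L = ?f ` screener_coords (2 * p) (- p) m"
    using assms screeners_eq_image_coords[OF gram_det_type2[OF assms], of "2 * p" "- p" m]
    by (simp add: type2_basis_iff)
  moreover have "?f ` {(1, 0), (- 1, 0), (1, 2), (- 1, - 2)} = Phi_bar a1 a2"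
    unfolding Phi_bar_def image_insert image_empty prod.case neg by simp
  moreover have "?f ` {(0, 1), (0, - 1), (1, 1), (- 1, - 1)} = {a2, - a2, a1 + a2, - (a1 + a2)}"
    unfolding image_insert image_empty prod.case neg by simp
  moreover have "?f ` {(1, - 1), (- 1, 1), (2, 1), (- 2, - 1)}
      = {a1 - a2, - (a1 - a2), 2 *\<^sub>R a1 + a2, - (2 *\<^sub>R a1 + a2)}"
    unfolding image_insert image_empty prod.case neg by simp
  ultimately show ?thesis
    unfolding coords image_Un if_distrib[of "image ?f"] image_empty by presburger
qed

lemma lattice_isometric_orthogonal_pair:
  assumes "gram_det a b \<noteq> 0" "a \<bullet> b = 0" "a \<bullet> a = c \<bullet> c" "b \<bullet> b = d \<bullet> d"
  shows "lattice_isometric (z_span {a, b}) (z_span {c} \<times> z_span {d})"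
  unfolding z_span_Times
  using assms by (intro lattice_isometric_z_span) (simp_all add: inner_Pair)

lemma z_span_Phi_bar: "z_span (Phi_bar a1 a2) = z_span {a1, a1 + 2 *\<^sub>R a2}"
  by (rule z_span_eq_of_generators)
    (auto simp: Phi_bar_def simp del: minus_add_distrib intro: int_module.span_neg int_module.span_base)

section \<open>The three subtypes of type 2\<close>

lemma type2_generic:
  assumes "type2_basis L p m a1 a2" "m \<noteq> 2 * p" "m \<noteq> p"
  shows "screeners L = Phi_bar a1 a2 \<and>
    z_span (screeners L) = z_span (Phi_bar a1 a2) \<and>
    is_orthogonal_sum (z_span (Phi_bar a1 a2)) (z_span {a1}) (z_span {a1 + 2 *\<^sub>R a2}) \<and>
    lattice_isometric (z_span (Phi_bar a1 a2))
      (rescale (sqrt (of_int (2 * p))) (\<int> :: real set) \<times>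
       rescale (sqrt (of_int (4 * m - 2 * p))) (\<int> :: real set))"
proof -
  have pm: "p > 0" "m \<ge> p" and gram: "a1 \<bullet> a1 = of_int (2 * p)" "a1 \<bullet> a2 = of_int (- p)" "a2 \<bullet> a2 = of_int m"
    using assms(1) by (auto simp: type2_basis_iff)
  have scr: "screeners L = Phi_bar a1 a2" using screeners_type2[OF assms(1)] assms(2,3) by simp
  let ?d = "a1 + 2 *\<^sub>R a2"
  have orth: "a1 \<bullet> ?d = 0" and norm: "?d \<bullet> ?d = of_int (4 * m - 2 * p)"
    using gram by (simp_all add: inner_simps inner_commute[of a2 a1])
  have "gram_det a1 ?d = of_int ((2 * p) * (4 * m - 2 * p))"
    unfolding gram_det_def orth norm gram(1) by simp
  then have "gram_det a1 ?d \<noteq> 0" using pm by auto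
  then have "lattice_isometric (z_span {a1, ?d})
      (z_span {sqrt (of_int (2 * p))} \<times> z_span {sqrt (of_int (4 * m - 2 * p))})"
    using pm orth norm gram(1) by (intro lattice_isometric_orthogonal_pair) simp_all
  then show ?thesis
    using scr is_orthogonal_sum_z_span[OF orth]
    unfolding z_span_Phi_bar Ints_eq_z_span rescale_z_span_singleton by (simp add: z_span_Phi_bar)
qed

text \<open>The rhombus is a square with orthogonal sides \<open>a1 + a2\<close>, \<open>a2\<close>
  of norm \<open>p\<close>; \<open>a1\<close> and \<open>a1 + 2 *\<^sub>R a2\<close> are their
  difference and sum. Over the sides the screeners for even \<open>p\<close> have the coordinates of
  a type B system. For odd \<open>p\<close> the sides have odd norm and drop out.\<close>

lemma type2_square:
  assumes "type2_basis L p p a1 a2"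
  shows "is_orthogonal_sum L (z_span {a1 + a2}) (z_span {a2}) \<and>
    lattice_isometric L
      (rescale (sqrt (of_int p)) (\<int> :: real set) \<times> rescale (sqrt (of_int p)) (\<int> :: real set)) \<and>
    lattice_isometric L
      (rescale (sqrt (of_int p / 2)) A1_lattice \<times> rescale (sqrt (of_int p / 2)) A1_lattice) \<and>
    (even p \<longrightarrow>
      z_span (screeners L) = L \<and>
      screeners L = Phi_bar a1 a2 \<union> {a2, - a2, a1 + a2, - (a1 + a2)} \<and>
      root_set_isometric (screeners L) (rescale (sqrt (of_int p / 2)) B2_roots) \<and>
      root_set_isometric (screeners L) (rescale (sqrt (of_int p / 2)) C2_roots)) \<and>
    (odd p \<longrightarrow> screeners L = Phi_bar a1 a2)"
proof -
  have p: "p > 0" and gram: "a1 \<bullet> a1 = of_int (2 * p)" "a1 \<bullet> a2 = of_int (- p)" "a2 \<bullet> a2 = of_int p"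
    using assms by (auto simp: type2_basis_iff)
  let ?e = "a1 + a2"
  have L: "L = z_span {?e, a2}" using exists_equal_norms_of_type2[OF assms] by simp
  have gram': "?e \<bullet> ?e = of_int p" "?e \<bullet> a2 = 0"
    using gram by (simp_all add: inner_simps inner_commute[of a2 a1])
  have "gram_det ?e a2 = of_int (p * p)"
    unfolding gram_det_def gram' gram(3) by simp
  then have D: "gram_det ?e a2 \<noteq> 0" using p by simp
  have Z: "lattice_isometric L (z_span {sqrt (of_int p)} \<times> z_span {sqrt (of_int p)})"
    unfolding L using p gram gram' by (intro lattice_isometric_orthogonal_pair[OF D]) simp_all
  have A1: "lattice_isometric L
     (z_span {sqrt (of_int p / 2) *\<^sub>R vector [1, - 1] :: real^2} \<times> z_span {sqrt (of_int p / 2) *\<^sub>R vector [1, - 1] :: real^2})"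
    unfolding L using p gram gram'
    by (intro lattice_isometric_orthogonal_pair[OF D]) (simp_all add: inner_vector_2 flip: mult.assoc)
  have even: "screeners L = Phi_bar a1 a2 \<union> {a2, - a2, a1 + a2, - (a1 + a2)}" if "even p"
    using screeners_type2[OF assms] that p by simp
  have span: "z_span (screeners L) = L" if "even p"
    unfolding L
  proof (rule z_span_eq_of_generators)
    show "{?e, a2} \<subseteq> screeners (z_span {?e, a2})"
      using even[OF that] unfolding L by simp
  qed (auto simp: screeners_def even_part_def)
  have coords: "screeners L = (\<lambda>(x, y). x *\<^sub>R ?e + y *\<^sub>R a2) ` B2_coords" if "even p"
  proof -
    have "1 *\<^sub>R ?e + (- 1) *\<^sub>R a2 = a1" "(- 1) *\<^sub>R ?e + 1 *\<^sub>R a2 = - a1"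
      "1 *\<^sub>R ?e + 1 *\<^sub>R a2 = a1 + 2 *\<^sub>R a2" "(- 1) *\<^sub>R ?e + (- 1) *\<^sub>R a2 = - (a1 + 2 *\<^sub>R a2)"
      "1 *\<^sub>R ?e + 0 *\<^sub>R a2 = ?e" "(- 1) *\<^sub>R ?e + 0 *\<^sub>R a2 = - ?e"
      "0 *\<^sub>R ?e + 1 *\<^sub>R a2 = a2" "0 *\<^sub>R ?e + (- 1) *\<^sub>R a2 = - a2"
      by (simp_all add: scaleR_2)
    note comb = this
    show ?thesis
      unfolding even[OF that] B2_coords_def Phi_bar_def image_insert image_empty prod.case comb
      by blast
  qed
  have root2: "(sqrt (of_int p / 2))\<^sup>2 = of_int p / 2" using p by simp
  have "root_set_isometric (screeners L) (rescale (sqrt (of_int p / 2)) B2_roots)" if "even p"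
    by (rule root_set_isometric_rescale[OF D _ _ _ coords[OF that] B2_roots_eq])
      (simp_all add: root2 inner_vector_2 gram gram')
  moreover have "root_set_isometric (screeners L) (rescale (sqrt (of_int p / 2)) C2_roots)" if "even p"
    by (rule root_set_isometric_rescale[OF D _ _ _ coords[OF that] C2_roots_eq])
      (simp_all add: root2 inner_vector_2 gram gram')
  moreover have "screeners L = Phi_bar a1 a2" if "odd p"
    using screeners_type2[OF assms] that p by simp
  moreover have "is_orthogonal_sum L (z_span {?e}) (z_span {a2})"
    unfolding L by (rule is_orthogonal_sum_z_span[OF gram'(2)])
  ultimately show ?thesis
    using Z A1 even span
    unfolding A1_lattice_eq Ints_eq_z_span rescale_z_span_singleton by simp
qed

text \<open>The Gram matrix is \<open>p\<close> times that of two simple roots of type A, so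
  \<open>a1\<close> and \<open>a2\<close> correspond to those roots scaled by \<open>sqrt p\<close>,
  and the screener coordinates are precisely \<open>G2_coords\<close>.\<close>

lemma type2_hexagonal:
  assumes "type2_basis L p (2 * p) a1 a2"
  shows "z_span (screeners L) = L \<and>
    lattice_isometric L (rescale (sqrt (of_int p)) A2_lattice) \<and>
    lattice_isometric L (rescale (sqrt (of_int p)) D2_lattice) \<and>
    screeners L = Phi_bar a1 a2 \<union>
      {a2, - a2, a1 + a2, - (a1 + a2), a1 - a2, - (a1 - a2),
       2 *\<^sub>R a1 + a2, - (2 *\<^sub>R a1 + a2)} \<and>
    root_set_isometric (screeners L) (rescale (sqrt (of_int p)) G2_roots)"
proof -
  have p: "p > 0" and L: "L = z_span {a1, a2}"
    and gram: "a1 \<bullet> a1 = of_int (2 * p)" "a1 \<bullet> a2 = of_int (- p)" "a2 \<bullet> a2 = of_int (2 * p)"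
    using assms by (auto simp: type2_basis_iff)
  note D = gram_det_type2[OF assms]
  have scr: "screeners L = Phi_bar a1 a2 \<union>
      {a2, - a2, a1 + a2, - (a1 + a2), a1 - a2, - (a1 - a2),
       2 *\<^sub>R a1 + a2, - (2 *\<^sub>R a1 + a2)}" (is "_ = ?S")
    unfolding screeners_type2[OF assms] by (simp only: simp_thms if_True) blast
  have span: "z_span (screeners L) = L"
    unfolding L
  proof (rule z_span_eq_of_generators)
    show "{a1, a2} \<subseteq> screeners (z_span {a1, a2})"
      using scr unfolding L by (simp add: Phi_bar_def)
  qed (auto simp: screeners_def even_part_def)
  have root: "(sqrt (of_int p))\<^sup>2 = of_int p" using p by simp
  have iso: "lattice_isometric L (z_span {sqrt (of_int p) *\<^sub>R vector [1, - 1, 0] :: real^3,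
      sqrt (of_int p) *\<^sub>R vector [0, 1, - 1]})"
    unfolding L using p
    by (intro lattice_isometric_z_span[OF D]) (simp_all add: inner_vector_3 gram)
  have coords: "screeners L = (\<lambda>(x, y). x *\<^sub>R a1 + y *\<^sub>R a2) ` G2_coords"
  proof -
    have "1 *\<^sub>R a1 + 0 *\<^sub>R a2 = a1" "(- 1) *\<^sub>R a1 + 0 *\<^sub>R a2 = - a1"
      "0 *\<^sub>R a1 + 1 *\<^sub>R a2 = a2" "0 *\<^sub>R a1 + (- 1) *\<^sub>R a2 = - a2"
      "1 *\<^sub>R a1 + 1 *\<^sub>R a2 = a1 + a2" "(- 1) *\<^sub>R a1 + (- 1) *\<^sub>R a2 = - (a1 + a2)"
      "1 *\<^sub>R a1 + 2 *\<^sub>R a2 = a1 + 2 *\<^sub>R a2" "(- 1) *\<^sub>R a1 + (- 2) *\<^sub>R a2 = - (a1 + 2 *\<^sub>R a2)"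
      "1 *\<^sub>R a1 + (- 1) *\<^sub>R a2 = a1 - a2" "(- 1) *\<^sub>R a1 + 1 *\<^sub>R a2 = - (a1 - a2)"
      "2 *\<^sub>R a1 + 1 *\<^sub>R a2 = 2 *\<^sub>R a1 + a2" "(- 2) *\<^sub>R a1 + (- 1) *\<^sub>R a2 = - (2 *\<^sub>R a1 + a2)"
      by simp_all
    note comb = this
    show ?thesis
      unfolding scr G2_coords_def Phi_bar_def image_insert image_empty prod.case comb
      by blast
  qed
  have "root_set_isometric (screeners L) (rescale (sqrt (of_int p)) G2_roots)"
    by (rule root_set_isometric_rescale[OF D _ _ _ coords G2_roots_eq])
      (simp_all add: root inner_vector_3 gram)
  then show ?thesis
    using span iso scr unfolding D2_lattice_def A2_lattice_eq rescale_z_span_pair by blast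
qed

lemma rank_2_lattice_basis:
  assumes "integral_lattice L" "has_rank L 2"
  obtains u v A B C where "L = z_span {u, v}" "gram_det u v \<noteq> 0"
    "u \<bullet> u = of_int A" "u \<bullet> v = of_int B" "v \<bullet> v = of_int C"
proof -
  obtain S where S: "card S = 2" "z_basis S L" using assms(2) by (auto simp: has_rank_def)
  from S(1) obtain u v where "S = {u, v}" "u \<noteq> v" by (auto simp: card_2_iff)
  then have L: "L = z_span {u, v}" and ind: "u \<noteq> v \<and> \<not> z_dependent {u, v}"
    using S(2) by (auto simp: z_basis_def)
  have "u \<in> L" "v \<in> L" unfolding L by (simp_all add: int_module.span_base)
  then have ints: "u \<bullet> u \<in> \<int>" "u \<bullet> v \<in> \<int>" "v \<bullet> v \<in> \<int>"
    using assms(1) by (simp_all add: integral_lattice_def)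
  from ints obtain A B C where "u \<bullet> u = of_int A" "u \<bullet> v = of_int B" "v \<bullet> v = of_int C"
    by (meson Ints_cases)
  moreover have "gram_det u v \<noteq> 0" using independent_pair_iff[OF ints(2,3)] ind by blast
  ultimately show thesis using that L by blast
qed

lemma exists_type2_iff_equal_norms:
  assumes "integral_lattice L" "has_rank L 2"
  shows "(\<exists>p m a1 a2. type2_basis L p m a1 a2) \<longleftrightarrow> (\<exists>u v. z_span {u, v} = L \<and> u \<bullet> u = v \<bullet> v)"
proof
  assume "\<exists>p m a1 a2. type2_basis L p m a1 a2"
  then show "\<exists>u v. z_span {u, v} = L \<and> u \<bullet> u = v \<bullet> v"
    using exists_equal_norms_of_type2 by blast
next
  assume "\<exists>u v. z_span {u, v} = L \<and> u \<bullet> u = v \<bullet> v"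
  then obtain u v where L: "L = z_span {u, v}" and norm: "u \<bullet> u = v \<bullet> v" by blast
  have "u \<in> L" "v \<in> L" unfolding L by (simp_all add: int_module.span_base)
  then have ints: "u \<bullet> u \<in> \<int>" "u \<bullet> v \<in> \<int>"
    using assms(1) by (simp_all add: integral_lattice_def)
  from ints(1) obtain n where n: "u \<bullet> u = of_int n" by (rule Ints_cases)
  from ints(2) obtain k where k: "u \<bullet> v = of_int k" by (rule Ints_cases)
  \<comment> \<open>The generators \<open>u\<close>, \<open>v\<close> are not assumed independent; a
    basis of \<open>L\<close> supplies a nonzero determinant, which passes to them because both
    pairs span \<open>L\<close>.\<close>
  obtain a b A B C where "L = z_span {a, b}" "gram_det a b \<noteq> 0"
    using rank_2_lattice_basis[OF assms] by metis
  then have "gram_det u v \<noteq> 0" using gram_det_nonzero_z_span L by metis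
  from exists_type2_of_equal_norms[OF this n k] n norm
  show "\<exists>p m a1 a2. type2_basis L p m a1 a2" unfolding L by simp
qed

text \<open>Type 2 lattices can be odd: \<open>p = m = 1\<close> gives two orthogonal vectors of
  norm 1 as sides. The coincidence is therefore stated for integral lattices generated by two
  vectors of equal norm, with evenness characterized separately by the parity of \<open>m\<close>.
  For the same reason the claims about screeners in the case \<open>m = p\<close> split by the
  parity of \<open>p\<close>.\<close>

theorem theorem5p12:
  fixes L :: "'a::real_inner set"
  assumes "integral_lattice L" and "has_rank L 2"
  shows
    "(screeners L \<noteq> {} \<longrightarrow>
        (\<exists>p m a1 a2. type1_basis L p m a1 a2 \<or> type2_basis L p m a1 a2)) \<and>
     ((\<exists>p m a1 a2. type2_basis L p m a1 a2) \<longleftrightarrow>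
        (\<exists>u v. z_span {u, v} = L \<and> u \<bullet> u = v \<bullet> v)) \<and>
     (\<forall>p m a1 a2. type2_basis L p m a1 a2 \<longrightarrow> (even_lattice L \<longleftrightarrow> even m)) \<and>
     (\<forall>p m a1 a2. type1_basis L p m a1 a2 \<longrightarrow>
        (odd m \<longrightarrow> screeners L = {a1, - a1}) \<and>
        (even m \<longrightarrow> screeners L = {a1, - a1, a2, - a2})) \<and>
     (\<forall>p m a1 a2. type2_basis L p m a1 a2 \<longrightarrow>
        (m \<noteq> 2 * p \<and> m \<noteq> p \<longrightarrow>
           screeners L = Phi_bar a1 a2 \<and>
           z_span (screeners L) = z_span (Phi_bar a1 a2) \<and>
           is_orthogonal_sum (z_span (Phi_bar a1 a2)) (z_span {a1}) (z_span {a1 + 2 *\<^sub>R a2}) \<and>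
           lattice_isometric (z_span (Phi_bar a1 a2))
             (rescale (sqrt (of_int (2 * p))) (\<int> :: real set) \<times>
              rescale (sqrt (of_int (4 * m - 2 * p))) (\<int> :: real set))) \<and>
        (m = p \<longrightarrow>
           is_orthogonal_sum L (z_span {a1 + a2}) (z_span {a2}) \<and>
           lattice_isometric L
             (rescale (sqrt (of_int p)) (\<int> :: real set) \<times>
              rescale (sqrt (of_int p)) (\<int> :: real set)) \<and>
           lattice_isometric L
             (rescale (sqrt (of_int p / 2)) A1_lattice \<times>
              rescale (sqrt (of_int p / 2)) A1_lattice) \<and>
           (even p \<longrightarrow>
              z_span (screeners L) = L \<and>
              screeners L = Phi_bar a1 a2 \<union> {a2, - a2, a1 + a2, - (a1 + a2)} \<and>
              root_set_isometric (screeners L) (rescale (sqrt (of_int p / 2)) B2_roots) \<and>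
              root_set_isometric (screeners L) (rescale (sqrt (of_int p / 2)) C2_roots)) \<and>
           (odd p \<longrightarrow> screeners L = Phi_bar a1 a2)) \<and>
        (m = 2 * p \<longrightarrow>
           z_span (screeners L) = L \<and>
           lattice_isometric L (rescale (sqrt (of_int p)) A2_lattice) \<and>
           lattice_isometric L (rescale (sqrt (of_int p)) D2_lattice) \<and>
           screeners L = Phi_bar a1 a2 \<union>
             {a2, - a2, a1 + a2, - (a1 + a2), a1 - a2, - (a1 - a2),
              2 *\<^sub>R a1 + a2, - (2 *\<^sub>R a1 + a2)} \<and>
           root_set_isometric (screeners L) (rescale (sqrt (of_int p)) G2_roots)))"
proof -
  obtain u v A B C where L: "L = z_span {u, v}" and "gram_det u v \<noteq> 0"
    "u \<bullet> u = of_int A" "u \<bullet> v = of_int B" "v \<bullet> v = of_int C"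
    using rank_2_lattice_basis[OF assms] by metis
  then have exists: "screeners L \<noteq> {} \<longrightarrow> (\<exists>p m a1 a2. type1_basis L p m a1 a2 \<or> type2_basis L p m a1 a2)"
    using exists_type_of_screener by blast
  show ?thesis
  proof (intro conjI, goal_cases)
    case 1
    show ?case by (rule exists)
  next
    case 2
    show ?case by (rule exists_type2_iff_equal_norms[OF assms])
  next
    case 3
    show ?case using even_lattice_type2_iff[OF assms(1)] by blast
  next
    case 4
    show ?case by (simp add: screeners_type1)
  next
    case 5
    show ?case (is "\<forall>p m a1 a2. _ \<longrightarrow> ?P p m a1 a2")
    proof (intro allI impI)
      fix p m a1 a2 assume t: "type2_basis L p m a1 a2"
      show "?P p m a1 a2"
      proof (rule conjI[OF _ conjI], goal_cases)
        case 1
        show ?case using type2_generic[OF t] by blast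
      next
        case 2
        show ?case by (rule impI, rule type2_square) (use t in simp)
      next
        case 3
        show ?case by (rule impI, rule type2_hexagonal) (use t in simp)
      qed
    qed
  qed
qed

end
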